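(* Let $N\ge1$, $\sigma\in\mathbb{R}$, $t>0$, $x_0\in\mathbb{R}^N$, and $$u_{\sigma,t}(x):=e^{\frac N4(\sigma-B_{N,\mathcal{L}})}\,B_{N,0}\left(\frac{t}{t^2+|x-x_0|^2}\right)^{\frac N2}\qquad\text{for all }x\in\mathbb{R}^N .$$ Then, for any $\sigma\in\mathbb{R}$, $u=u_{\sigma,t}$ is a (classical) solution of $$\mathcal{L}_\Delta u=\sigma u+\frac{1}{\|u\|_2^2}\left[G_{\ln}(u)-\frac4N\left(\int_{\mathbb{R}^N}u^2\ln u\,dx\right)\right]u\qquad\text{in }\mathbb{R}^N .$$
   Context: The logarithmic Laplacian is $$\mathcal{L}_\Delta u(x)=c_N\int_{\mathbb{R}^N}\frac{u(x)\mathbf{1}_{B_1(x)}(y)-u(y)}{|x-y|^N}\,dy+\rho_N u(x),\quad c_N=\pi^{-N/2}\Gamma\Big(\frac N2\Big),\quad \rho_N=2\ln2+\psi\Big(\frac N2\Big)-\gamma,$$ where $\gamma=-\Gamma'(1)$ and $\psi=\Gamma'/\Gamma$. The logarithmic potential is $G_{\ln}(u)(x)=\int_{\mathbb{R}^N}\ln\big(|x-y|^{-4}\big)u^2(y)\,dy$. Constants: $$B_{N,0}=\Big(\frac{\Gamma(N)}{\pi^{N/2}\Gamma(N/2)}\Big)^{1/2},\quad B_{N,1}=B_{N,0}\Big[\ln 2+2\psi\Big(\frac N2\Big)-\psi(N)\Big],\quad B_{N,\mathcal{L}}=2\frac{B_{N,1}}{B_{N,0}}+\frac4N\ln(B_{N,0}).$$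 Function classes: $L^1_0(\mathbb{R}^N)$ is the set of measurable $u$ with $\int_{\mathbb{R}^N}\frac{|u(x)|}{1+|x|^N}dx<\infty$. $D_0(\mathbb{R}^N)$ is the set of functions Dini continuous at every $x\in\mathbb{R}^N$, i.e. $\int_0^1\frac{\omega_{u,x}(r)}{r}dr<\infty$ with $\omega_{u,x}(r)=\sup_{|y-x|\le r}|u(y)-u(x)|$. And $$\mathbb{H}_{\ln}(\mathbb{R}^N)=\Big\{u\in L^2(\mathbb{R}^N):\int_{\mathbb{R}^N}u^2\ln(e+|x|^2)dx+\Big|\int_{\mathbb{R}^N}u^2\ln|u|\,dx\Big|<\infty\Big\}.$$ A (classical) solution of the equation is a function $u\in L^1_0(\mathbb{R}^N)\cap D_0(\mathbb{R}^N)\cap\mathbb{H}_{\ln}(\mathbb{R}^N)$ satisfying the equation pointwise. *)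

theory Defs
  imports "HOL-Analysis.Analysis"
begin

text \<open>
  The dimension of \<open>real ^ 'n\<close> is \<open>N = CARD('n)\<close>, and \<open>lebesgue\<close> (the completion of \<open>lborel\<close>)
  carries all measurability and integrability conditions. The symbols \<open>\<psi>\<close> and \<open>\<gamma>\<close> are
  \<open>Digamma\<close> and \<open>euler_mascheroni\<close>; the next two lemmas confirm that these are
  \<open>\<Gamma>' / \<Gamma>\<close> and \<open>- \<Gamma>'(1)\<close>.
\<close>

lemma Digamma_eq_deriv_Gamma:
  fixes x :: real
  assumes "x > 0"
  shows "Digamma x = deriv Gamma x / Gamma x"
proof -
  have x: "x \<notin> \<int>\<^sub>\<le>\<^sub>0"
    using assms by (auto elim!: nonpos_Ints_cases)
  have "deriv Gamma x = Gamma x * Digamma x"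
    by (rule DERIV_imp_deriv) (rule has_field_derivative_Gamma[OF x])
  then show ?thesis
    using Gamma_real_pos[OF assms] by simp
qed

lemma euler_mascheroni_eq_deriv_Gamma:
  "(euler_mascheroni :: real) = - deriv Gamma 1"
  using Digamma_eq_deriv_Gamma[of 1] by simp

definition c_const :: "nat \<Rightarrow> real" where
  "c_const N = pi powr (- (real N / 2)) * Gamma (real N / 2)"

definition rho_const :: "nat \<Rightarrow> real" where
  "rho_const N = 2 * ln 2 + Digamma (real N / 2) - euler_mascheroni"

definition B0_const :: "nat \<Rightarrow> real" where
  "B0_const N = sqrt (Gamma (real N) / (pi powr (real N / 2) * Gamma (real N / 2)))"

definition B1_const :: "nat \<Rightarrow> real" where
  "B1_const N = B0_const N * (ln 2 + 2 * Digamma (real N / 2) - Digamma (real N))"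

definition BL_const :: "nat \<Rightarrow> real" where
  "BL_const N = 2 * (B1_const N / B0_const N) + 4 / real N * ln (B0_const N)"

text \<open>
  For \<open>u\<close> in \<open>L10 \<inter> D0\<close> the integrand below is Lebesgue integrable for every \<open>x\<close>, by Dini
  continuity on the unit ball around \<open>x\<close> and by the weighted integrability outside it. For \<open>u\<close>
  in \<open>D0 \<inter> Hln\<close> the same holds for the integrand of \<open>G_ln\<close>.
\<close>

definition log_laplacian :: "(real ^ 'n \<Rightarrow> real) \<Rightarrow> real ^ 'n \<Rightarrow> real" where
  "log_laplacian u x =
     c_const CARD('n) *
       (LINT y|lebesgue. (u x * indicator (ball x 1) y - u y) / norm (x - y) ^ CARD('n))
     + rho_const CARD('n) * u x"

definition G_ln :: "(real ^ 'n \<Rightarrow> real) \<Rightarrow> real ^ 'n \<Rightarrow> real" where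
  "G_ln u x = (LINT y|lebesgue. ln (norm (x - y) powi (- 4)) * (u y)\<^sup>2)"

definition L2_norm :: "(real ^ 'n \<Rightarrow> real) \<Rightarrow> real" where
  "L2_norm u = sqrt (LINT x|lebesgue. (u x)\<^sup>2)"

definition L10 :: "(real ^ 'n \<Rightarrow> real) set" where
  "L10 = {u. u \<in> borel_measurable lebesgue \<and>
             integrable lebesgue (\<lambda>x. \<bar>u x\<bar> / (1 + norm x ^ CARD('n)))}"

text \<open>The modulus is \<open>ennreal\<close>-valued, so that it is \<open>\<infinity>\<close> when \<open>u\<close> is unbounded on the ball.\<close>

definition dini_modulus :: "(real ^ 'n \<Rightarrow> real) \<Rightarrow> real ^ 'n \<Rightarrow> real \<Rightarrow> ennreal" where
  "dini_modulus u x r = (SUP y\<in>cball x r. ennreal \<bar>u y - u x\<bar>)"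

definition D0 :: "(real ^ 'n \<Rightarrow> real) set" where
  "D0 = {u. \<forall>x. (\<integral>\<^sup>+r\<in>{0<..<1}. dini_modulus u x r / ennreal r \<partial>lebesgue) < \<infinity>}"

text \<open>Finiteness of the integral of \<open>u\<^sup>2 ln |u|\<close>, which may change sign, means integrability.\<close>

definition Hln :: "(real ^ 'n \<Rightarrow> real) set" where
  "Hln = {u. u \<in> borel_measurable lebesgue \<and>
             integrable lebesgue (\<lambda>x. (u x)\<^sup>2) \<and>
             integrable lebesgue (\<lambda>x. (u x)\<^sup>2 * ln (exp 1 + (norm x)\<^sup>2)) \<and>
             integrable lebesgue (\<lambda>x. (u x)\<^sup>2 * ln \<bar>u x\<bar>)}"

text \<open>Solutions of the equation in which the logarithmic Laplacian of \<open>u\<close> equals \<open>F u\<close>.\<close>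

definition classical_solution ::
  "((real ^ 'n \<Rightarrow> real) \<Rightarrow> real ^ 'n \<Rightarrow> real) \<Rightarrow> (real ^ 'n \<Rightarrow> real) \<Rightarrow> bool" where
  "classical_solution F u \<longleftrightarrow> u \<in> L10 \<inter> D0 \<inter> Hln \<and> (\<forall>x. log_laplacian u x = F u x)"

end

theory Submission
  imports Defs
begin

text \<open>
  Let \<open>N\<close> be the dimension, \<open>a = N / 2\<close>, and call \<open>w y = (t / (t\<^sup>2 + |y|\<^sup>2))\<^sup>a\<close> the bubble of scale \<open>t\<close>;
  the functions of the theorem are multiples of its translates. Fix a point \<open>b\<close>, measured
  from the centre of the bubble, and put \<open>A = t\<^sup>2 + |b|\<^sup>2\<close>. Everything rests on one symmetry: the
  inversion \<open>z \<mapsto> A z / |z|\<^sup>2\<close> of the displacement from \<open>b\<close> reproduces the bubble up to a power of \<open>|z|\<close>, since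
  \<open>t\<^sup>2 + |b + A z / |z|\<^sup>2|\<^sup>2 = A (t\<^sup>2 + |b + z|\<^sup>2) / |z|\<^sup>2\<close> (lemma \<open>quadratic_inversion\<close>), and it preserves the
  measure \<open>|z|\<^sup>-\<^sup>N dz\<close> (lemma \<open>integral_inversion\<close>).

  \<^item> Potential. The inversion preserves \<open>w\<^sup>2(b + z) dz\<close> and changes the sign of \<open>ln (|z|\<^sup>2 / A)\<close>, so
    the integral of \<open>ln (|z|\<^sup>2 / A) w\<^sup>2(b + z)\<close> vanishes (lemma \<open>bubble_potential\<close>). Hence the mean of
    \<open>ln |b - y|\<close> with weight \<open>w\<^sup>2\<close> is \<open>ln A / 2\<close>.

  \<^item> Logarithmic Laplacian. The inversion turns its integrand into \<open>w b\<close> times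
    \<open>1\<^bsub>|z| > A\<^esub> |z|\<^sup>-\<^sup>N - (t\<^sup>2 + |b + z|\<^sup>2)\<^sup>-\<^sup>a\<close>. Both terms diverge at infinity, but replacing \<open>b + z\<close> by \<open>z\<close>
    in the second one costs only a difference \<open>k z - k (b + z)\<close> with \<open>k\<close> even, which is integrable
    and odd under the reflection about \<open>- b / 2\<close>, so that its integral vanishes. What remains is radial,
    and its value is affine in \<open>ln (t / A)\<close> (lemma \<open>bubble_logarithmic_laplacian\<close>).

  Both sides of the equation are thus \<open>u\<close> times the sum of a constant and \<open>2 ln (t / A)\<close>, where
  \<open>t / A\<close> is the base of the power \<open>w b\<close>. To compare the constants, three radial integrals
  are needed: the mass and the entropy of the bubble, and the cut-off integral above. In the variable
  \<open>v = |z|\<^sup>2 / (t\<^sup>2 + |z|\<^sup>2)\<close> they become the Beta integral, its derivative in a parameter, and, up to a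
  logarithm, Gauss's integral for \<open>\<psi> + \<gamma>\<close>. Multiplying \<open>w\<close> by \<open>\<kappa>\<close> adds only the term \<open>- (4 / N) ln \<kappa>\<close>
  to the right-hand side, and the prefactor in the theorem is the value of \<open>\<kappa>\<close> at which the
  constants agree.
\<close>

section \<open>Beta-type integrals on the unit interval\<close>

lemma absolutely_integrable_eq:
  fixes f g :: "real \<Rightarrow> real"
  assumes "f absolutely_integrable_on S" "\<And>x. x \<in> S \<Longrightarrow> f x = g x"
  shows "g absolutely_integrable_on S"
  by (rule set_integrable_cong[OF refl refl assms(2), THEN iffD1, OF _ assms(1)])

lemma has_integral_Beta_Ioo:
  fixes a b :: real
  assumes "a > 0" "b > 0"
  shows "((\<lambda>v. v powr (a - 1) * (1 - v) powr (b - 1)) has_integral Beta a b) {0<..<1}"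
  using has_integral_Beta_real[OF assms] by (simp add: has_integral_Icc_iff_Ioo)

lemma absolutely_integrable_Beta_Ioo:
  fixes a b :: real
  assumes "a > 0" "b > 0"
  shows "(\<lambda>v. v powr (a - 1) * (1 - v) powr (b - 1)) absolutely_integrable_on {0<..<1}"
  using has_integral_Beta_Ioo[OF assms]
  by (intro nonnegative_absolutely_integrable_1) (auto simp: has_integral_integrable_integral)

lemma filterlim_inverse_Suc_at_0: "filterlim (\<lambda>n. inverse (real (Suc n))) (at 0) sequentially"
  by (rule filterlim_atI[OF LIMSEQ_inverse_real_of_nat]) auto

text \<open>
  This is the derivative of the Beta integral in its second parameter. The difference quotients
  with steps \<open>1 / (n + 1)\<close> converge under the integral because \<open>|((1 - v)\<^sup>h - 1) / h| \<le> - ln (1 - v)\<close>,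
  and the logarithm is absorbed by half of the exponent \<open>b\<close>.
\<close>

lemma has_integral_Beta_ln:
  fixes a b :: real
  assumes a: "a > 0" and b: "b > 0"
  shows "((\<lambda>v. v powr (a - 1) * (1 - v) powr (b - 1) * ln (1 - v)) has_integral
           Beta a b * (Digamma b - Digamma (a + b))) {0<..<1}"
proof (rule has_integral_dominated_convergence)
  let ?h = "\<lambda>n. inverse (real (Suc n))"
  let ?\<beta> = "\<lambda>v. v powr (a - 1) * (1 - v) powr (b - 1)"
  show "((\<lambda>v. ?\<beta> v * (((1 - v) powr ?h n - 1) / ?h n)) has_integral
           (Beta a (b + ?h n) - Beta a b) / ?h n) {0<..<1}" for n
  proof -
    have h: "?h n > 0"
      by simp
    have bh: "b + ?h n > 0"
      using b h by (rule add_pos_pos)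
    have "((\<lambda>v. (v powr (a - 1) * (1 - v) powr (b + ?h n - 1) - ?\<beta> v) / ?h n) has_integral
            (Beta a (b + ?h n) - Beta a b) / ?h n) {0<..<1}"
      by (intro has_integral_divide has_integral_diff has_integral_Beta_Ioo a b bh)
    then show ?thesis
    proof (rule has_integral_eq[rotated])
      fix v :: real
      assume v: "v \<in> {0<..<1}"
      have "(1 - v) powr (b + ?h n - 1) = (1 - v) powr (b - 1) * (1 - v) powr ?h n"
        by (simp add: powr_add[symmetric] algebra_simps)
      then show "(v powr (a - 1) * (1 - v) powr (b + ?h n - 1) - ?\<beta> v) / ?h n
                   = ?\<beta> v * (((1 - v) powr ?h n - 1) / ?h n)"
        by (simp add: algebra_simps diff_divide_distrib)
    qed
  qed
  show "(\<lambda>v. 2 / b * (v powr (a - 1) * (1 - v) powr (b / 2 - 1))) integrable_on {0<..<1}"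
    using has_integral_Beta_Ioo[of a "b / 2"] a b
    by (intro integrable_on_mult_right) (auto simp: has_integral_integrable_integral)
  show "\<forall>v\<in>{0<..<1}. norm (?\<beta> v * (((1 - v) powr ?h n - 1) / ?h n))
          \<le> 2 / b * (v powr (a - 1) * (1 - v) powr (b / 2 - 1))" for n
  proof
    fix v :: real
    assume v: "v \<in> {0<..<1}"
    have h: "?h n > 0"
      by simp
    have "1 + ?h n * ln (1 - v) \<le> (1 - v) powr ?h n"
      using v exp_ge_add_one_self[of "?h n * ln (1 - v)"] by (simp add: powr_def)
    moreover have "(1 - v) powr ?h n \<le> 1"
      using v h by (intro powr_le1) auto
    ultimately have "\<bar>((1 - v) powr ?h n - 1) / ?h n\<bar> \<le> - ln (1 - v)"
      using h by (simp add: field_simps del: of_nat_Suc)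
    also have "- ln (1 - v) \<le> (inverse (1 - v)) powr (b / 2) / (b / 2)"
      using v b ln_powr_bound[of "inverse (1 - v)" "b / 2"]
      by (simp add: one_le_inverse flip: ln_inverse)
    also have "\<dots> = 2 / b * (1 - v) powr (- (b / 2))"
      using v by (simp add: powr_minus inverse_powr)
    finally have "?\<beta> v * \<bar>((1 - v) powr ?h n - 1) / ?h n\<bar>
        \<le> ?\<beta> v * (2 / b * (1 - v) powr (- (b / 2)))"
      by (intro mult_left_mono) auto
    also have "\<dots> = 2 / b * (v powr (a - 1) * ((1 - v) powr (b - 1) * (1 - v) powr (- (b / 2))))"
      by simp
    also have "(1 - v) powr (b - 1) * (1 - v) powr (- (b / 2)) = (1 - v) powr (b / 2 - 1)"
      by (simp add: powr_add[symmetric] algebra_simps)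
    finally show "norm (?\<beta> v * (((1 - v) powr ?h n - 1) / ?h n))
          \<le> 2 / b * (v powr (a - 1) * (1 - v) powr (b / 2 - 1))"
      by (simp add: abs_mult del: of_nat_Suc)
  qed
  show "\<forall>v\<in>{0<..<1}. (\<lambda>n. ?\<beta> v * (((1 - v) powr ?h n - 1) / ?h n))
          \<longlonglongrightarrow> ?\<beta> v * ln (1 - v)"
  proof
    fix v :: real
    assume v: "v \<in> {0<..<1}"
    have "((\<lambda>h. (1 - v) powr h) has_real_derivative ln (1 - v)) (at 0)"
      using v by (auto intro!: derivative_eq_intros)
    then have "((\<lambda>h. ((1 - v) powr h - 1) / h) \<longlongrightarrow> ln (1 - v)) (at 0)"
      using v by (simp add: DERIV_def)
    from filterlim_compose[OF this filterlim_inverse_Suc_at_0]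
    show "(\<lambda>n. ?\<beta> v * (((1 - v) powr ?h n - 1) / ?h n)) \<longlonglongrightarrow> ?\<beta> v * ln (1 - v)"
      by (intro tendsto_mult_left)
  qed
  have "((\<lambda>y. Beta a y) has_real_derivative Beta a b * (Digamma b - Digamma (a + b))) (at b)"
    using a b by (intro has_field_derivative_Beta2) (auto elim!: nonpos_Ints_cases)
  then have "((\<lambda>h. (Beta a (b + h) - Beta a b) / h) \<longlongrightarrow> Beta a b * (Digamma b - Digamma (a + b)))
      (at 0)"
    by (simp add: DERIV_def)
  from filterlim_compose[OF this filterlim_inverse_Suc_at_0]
  show "(\<lambda>n. (Beta a (b + ?h n) - Beta a b) / ?h n)
          \<longlonglongrightarrow> Beta a b * (Digamma b - Digamma (a + b))" .
qed

lemma absolutely_integrable_Beta_ln: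
  fixes a b :: real
  assumes "a > 0" "b > 0"
  shows "(\<lambda>v. v powr (a - 1) * (1 - v) powr (b - 1) * ln (1 - v)) absolutely_integrable_on {0<..<1}"
proof -
  have "(\<lambda>v. - (v powr (a - 1) * (1 - v) powr (b - 1) * ln (1 - v))) absolutely_integrable_on {0<..<1}"
    using has_integral_neg[OF has_integral_Beta_ln[OF assms]]
    by (intro nonnegative_absolutely_integrable_1)
       (auto simp: has_integral_integrable_integral mult_nonneg_nonpos)
  from set_integrable_mult_right[OF this, of "- 1"] show ?thesis
    by simp
qed

text \<open>
  Gauss's integral. With the regularising factor \<open>(1 - v)\<^sup>h\<close> the integral is \<open>Beta 1 h - Beta a h\<close>,
  a difference quotient of \<open>h \<mapsto> - Gamma a * Gamma (1 + h) / Gamma (a + h)\<close> at \<open>0\<close>. The integrand has constant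
  sign, positive for \<open>a > 1\<close> and negative for \<open>a < 1\<close>, and its modulus grows as \<open>h\<close> decreases, so monotone
  convergence yields the limit and the integrability together.
\<close>

lemma Digamma_Gauss_integral:
  fixes a :: real
  assumes a: "a > 0"
  shows "(\<lambda>v. (1 - v powr (a - 1)) / (1 - v)) absolutely_integrable_on {0<..<1}"
    and "((\<lambda>v. (1 - v powr (a - 1)) / (1 - v)) has_integral Digamma a + euler_mascheroni) {0<..<1}"
proof -
  define \<epsilon> :: real where "\<epsilon> = (if a \<ge> 1 then 1 else - 1)"
  let ?h = "\<lambda>n. inverse (real (Suc n))"
  let ?f = "\<lambda>n v. \<epsilon> * (1 - v powr (a - 1)) * (1 - v) powr (?h n - 1)"
  let ?g = "\<lambda>v. \<epsilon> * (1 - v powr (a - 1)) / (1 - v)"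
  have \<epsilon>: "\<epsilon> * \<epsilon> = 1"
    by (simp add: \<epsilon>_def)
  have sgn: "\<epsilon> * (1 - v powr (a - 1)) \<ge> 0" if "v \<in> {0<..<1}" for v :: real
  proof (cases "a \<ge> 1")
    case True
    then show ?thesis
      using that by (simp add: \<epsilon>_def powr_le1)
  next
    case False
    then have "v powr 0 \<le> v powr (a - 1)"
      using that by (intro powr_mono') auto
    with False that show ?thesis
      by (simp add: \<epsilon>_def)
  qed
  have f: "(?f n has_integral \<epsilon> * (Beta 1 (?h n) - Beta a (?h n))) {0<..<1}" for n
  proof -
    have "((\<lambda>v. \<epsilon> * (v powr (1 - 1) * (1 - v) powr (?h n - 1) - v powr (a - 1) * (1 - v) powr (?h n - 1)))
        has_integral \<epsilon> * (Beta 1 (?h n) - Beta a (?h n))) {0<..<1}"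
      using a by (intro has_integral_mult_right has_integral_diff has_integral_Beta_Ioo) auto
    then show ?thesis
      by (rule has_integral_eq[rotated]) (auto simp: algebra_simps)
  qed
  have lim: "(\<lambda>n. Beta 1 (?h n) - Beta a (?h n)) \<longlonglongrightarrow> Digamma a + euler_mascheroni"
  proof -
    let ?G = "\<lambda>h. 1 - Gamma a * Gamma (1 + h) / Gamma (a + h)"
    have "(?G has_real_derivative Digamma a + euler_mascheroni) (at 0)"
      using a
      by (auto intro!: derivative_eq_intros elim!: nonpos_Ints_cases
               simp: field_simps power2_eq_square Gamma_real_pos[OF a, THEN less_imp_neq, symmetric])
    then have "((\<lambda>h. (1 - Gamma a * Gamma (1 + h) / Gamma (a + h)) / h)
        \<longlongrightarrow> Digamma a + euler_mascheroni) (at 0)"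
      using Gamma_real_pos[OF a] by (simp add: DERIV_def)
    from filterlim_compose[OF this filterlim_inverse_Suc_at_0]
    have "(\<lambda>n. (1 - Gamma a * Gamma (1 + ?h n) / Gamma (a + ?h n)) / ?h n)
        \<longlonglongrightarrow> Digamma a + euler_mascheroni" .
    moreover have "(1 - Gamma a * Gamma (1 + h) / Gamma (a + h)) / h = Beta 1 h - Beta a h"
      if h: "h > 0" for h
    proof -
      have "Gamma (1 + h) = h * Gamma h"
        using Gamma_plus1[of h] h nonpos_Ints_nonpos[of h] by (force simp: add.commute)
      moreover have "Gamma h \<noteq> 0" "Gamma (a + h) \<noteq> 0"
        using a h Gamma_real_pos[of h] Gamma_real_pos[of "a + h"] by linarith+
      ultimately show ?thesis
        using h by (simp add: Beta_def divide_simps)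
    qed
    ultimately show ?thesis
      by simp
  qed
  have conv: "(\<lambda>n. integral {0<..<1} (?f n)) \<longlonglongrightarrow> \<epsilon> * (Digamma a + euler_mascheroni)"
    using tendsto_mult_left[OF lim, of \<epsilon>] integral_unique[OF f] by simp
  have "?g integrable_on {0<..<1} \<and>
      (\<lambda>n. integral {0<..<1} (?f n)) \<longlonglongrightarrow> integral {0<..<1} ?g"
  proof (rule monotone_convergence_increasing)
    show "?f n integrable_on {0<..<1}" for n
      using f by (auto simp: integrable_on_def)
    show "?f n v \<le> ?f (Suc n) v" if v: "v \<in> {0<..<1}" for n v
      using sgn[OF v] v by (intro mult_left_mono powr_mono') (auto simp: field_simps)
    show "(\<lambda>n. ?f n v) \<longlonglongrightarrow> ?g v" if v: "v \<in> {0<..<1}" for v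
    proof -
      have "(\<lambda>n. (1 - v) powr (?h n - 1)) \<longlonglongrightarrow> (1 - v) powr (0 - 1)"
        using v by (intro tendsto_intros LIMSEQ_inverse_real_of_nat) auto
      from tendsto_mult_left[OF this, of "\<epsilon> * (1 - v powr (a - 1))"] v show ?thesis
        by (simp add: powr_minus divide_inverse)
    qed
    show "bounded (range (\<lambda>n. integral {0<..<1} (?f n)))"
      using conv by (intro convergent_imp_bounded) (auto simp: convergent_def)
  qed
  then have g: "(?g has_integral \<epsilon> * (Digamma a + euler_mascheroni)) {0<..<1}"
    using LIMSEQ_unique[OF conv, of "integral {0<..<1} ?g"]
    by (simp only: has_integral_integrable_integral)
  have eq: "(\<lambda>v. \<epsilon> * ?g v) = (\<lambda>v. (1 - v powr (a - 1)) / (1 - v))"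
    using \<epsilon> by (simp add: fun_eq_iff flip: mult.assoc)
  have "?g absolutely_integrable_on {0<..<1}"
    using g sgn by (intro nonnegative_absolutely_integrable_1)
      (auto simp: has_integral_integrable_integral)
  then have "(\<lambda>v. \<epsilon> * ?g v) absolutely_integrable_on {0<..<1}"
    by (rule set_integrable_mult_right)
  then show "(\<lambda>v. (1 - v powr (a - 1)) / (1 - v)) absolutely_integrable_on {0<..<1}"
    by (simp only: eq)
  show "((\<lambda>v. (1 - v powr (a - 1)) / (1 - v)) has_integral Digamma a + euler_mascheroni) {0<..<1}"
    using has_integral_mult_right[OF g, of \<epsilon>] \<epsilon> unfolding eq by (simp flip: mult.assoc)
qed

text \<open>
  The integrand is \<open>- 1 / (1 - v)\<close> below \<open>c\<close> and \<open>1 / v\<close> above it: the jump removes the singularities at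
  both ends of the interval. Added to Gauss's integrand, it replaces
  the constant \<open>1\<close> there by \<open>1 / v\<close> for \<open>v > c\<close> and by \<open>0\<close> for \<open>v \<le> c\<close>.
\<close>

lemma cutoff_integral:
  fixes c :: real
  assumes c: "0 < c" "c < 1"
  defines "f \<equiv> (\<lambda>v. (indicator {c<..} v / v - 1) / (1 - v))"
  shows "f absolutely_integrable_on {0<..<1}"
    and "(f has_integral ln ((1 - c) / c)) {0<..<1}"
proof -
  have left: "((\<lambda>v. 1 / (1 - v)) has_integral (- ln (1 - c)) - (- ln (1 - 0))) {0..c}"
    using c by (intro fundamental_theorem_of_calculus)
      (auto intro!: derivative_eq_intros simp: divide_simps
            simp flip: has_real_derivative_iff_has_vector_derivative)
  have right: "((\<lambda>v. 1 / v) has_integral ln 1 - ln c) {c..1}"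
    using c by (intro fundamental_theorem_of_calculus)
      (auto intro!: derivative_eq_intros simp flip: has_real_derivative_iff_has_vector_derivative)
  have f: "(f has_integral ln (1 - c)) {0..c}"
    using c by (intro has_integral_eq[OF _ has_integral_neg[OF left, simplified]])
      (auto simp: f_def)
  have af: "((\<lambda>v. \<bar>f v\<bar>) has_integral - ln (1 - c)) {0..c}"
    using c by (intro has_integral_eq[OF _ left[simplified]]) (auto simp: f_def)
  have f_right: "f v = 1 / v" if "v \<in> {c..1} - {c, 1}" for v
    using that c by (auto simp: f_def field_simps)
  have g: "(f has_integral - ln c) {c..1}"
    using f_right by (intro has_integral_spike_finite[OF _ _ right[simplified], of "{c, 1}"]) auto
  have ag: "((\<lambda>v. \<bar>f v\<bar>) has_integral - ln c) {c..1}"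
    using f_right c
    by (intro has_integral_spike_finite[OF _ _ right[simplified], of "{c, 1}"]) auto
  have "(f has_integral ln (1 - c) + - ln c) {0..1}"
    using c f g by (intro has_integral_combine[of 0 c 1]) auto
  then show int: "(f has_integral ln ((1 - c) / c)) {0<..<1}"
    using c by (simp add: has_integral_Icc_iff_Ioo ln_div)
  have "((\<lambda>v. \<bar>f v\<bar>) has_integral - ln (1 - c) + - ln c) {0..1}"
    using c af ag by (intro has_integral_combine[of 0 c 1]) auto
  then have "((\<lambda>v. \<bar>f v\<bar>) has_integral - ln (1 - c) + - ln c) {0<..<1}"
    by (simp add: has_integral_Icc_iff_Ioo)
  with int show "f absolutely_integrable_on {0<..<1}"
    by (auto simp: absolutely_integrable_on_def integrable_on_def)
qed

section \<open>Radial integrals\<close>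

text \<open>
  The image of Lebesgue measure under the norm has the density of the surface areas of spheres.
  It suffices to compare half-lines \<open>{..<c}\<close>, whose preimages are balls.
\<close>

lemma distr_norm_lborel:
  "distr (lborel :: 'a::euclidean_space measure) borel norm =
     density lborel (\<lambda>r. ennreal (unit_ball_vol DIM('a) * (DIM('a) * r ^ (DIM('a) - 1))) *
                          indicator {0..} r)"
    (is "?D = ?R")
proof -
  let ?n = "DIM('a)" and ?V = "unit_ball_vol DIM('a)"
  let ?\<rho> = "\<lambda>r::real. ?V * (?n * r ^ (?n - 1))"
  have D: "emeasure ?D {..< c} = emeasure ?R {..< c}"
      and fin: "emeasure ?D {..< c} < \<infinity>" for c
  proof -
    have ball: "emeasure ?D {..< c} = emeasure lborel (ball 0 c :: 'a set)"
      by (subst emeasure_distr) (auto intro!: arg_cong[where f = "emeasure lborel"])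
    show "emeasure ?D {..< c} < \<infinity>"
      unfolding ball by (rule emeasure_bounded_finite) auto
    show "emeasure ?D {..< c} = emeasure ?R {..< c}"
    proof (cases "c > 0")
      case True
      have "emeasure ?R {..< c} = (\<integral>\<^sup>+r. ennreal (?\<rho> r) * indicator {0..c} r \<partial>lborel)"
      proof (subst emeasure_density)
        show "(\<integral>\<^sup>+r. ennreal (?\<rho> r) * indicator {0..} r * indicator {..<c} r \<partial>lborel) =
              (\<integral>\<^sup>+r. ennreal (?\<rho> r) * indicator {0..c} r \<partial>lborel)"
          by (rule nn_integral_cong_AE, rule AE_mp[OF AE_lborel_singleton[of "c"]], rule AE_I2)
             (auto simp: indicator_def)
      qed auto
      also have "\<dots> = ennreal (?V * c ^ ?n - ?V * 0 ^ ?n)"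
        using True
        by (intro nn_integral_FTC_Icc[where F = "\<lambda>r::real. ?V * r ^ ?n"])
           (auto intro!: derivative_eq_intros)
      finally show ?thesis
        using True unfolding ball by (simp add: emeasure_ball zero_power)
    next
      case False
      have "emeasure ?R {..< c} = 0"
      proof (subst emeasure_density)
        have "(\<integral>\<^sup>+r. ennreal (?\<rho> r) * indicator {0..} r * indicator {..<c} r \<partial>lborel) =
              (\<integral>\<^sup>+r. 0 \<partial>(lborel :: real measure))"
          using False by (intro nn_integral_cong) (auto split: split_indicator)
        then show "(\<integral>\<^sup>+r. ennreal (?\<rho> r) * indicator {0..} r * indicator {..<c} r \<partial>lborel) = 0"
          by simp
      qed auto
      with False show ?thesis
        unfolding ball by (simp add: ball_empty)
    qed
  qed
  show ?thesis
  proof (rule measure_eqI_generator_eq_countable)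
    let ?LT = "\<lambda>a::real. {..<a}"
    let ?E = "range ?LT"
    show "Int_stable ?E"
      unfolding Int_stable_def
    proof (intro ballI)
      fix X Y
      assume "X \<in> ?E" "Y \<in> ?E"
      then obtain a b where "X = {..<a}" "Y = {..<b}"
        by auto
      then have "X \<inter> Y = {..<min a b}"
        by auto
      then show "X \<inter> Y \<in> ?E"
        by blast
    qed
    show "?E \<subseteq> Pow UNIV" "sets ?D = sigma_sets UNIV ?E" "sets ?R = sigma_sets UNIV ?E"
      by (simp_all add: borel_Iio)
    show "?LT ` \<rat> \<subseteq> ?E" "countable (?LT ` \<rat>)"
      by (auto intro: countable_rat)
    show "(\<Union>(?LT ` \<rat>)) = UNIV"
    proof (intro equalityI subsetI)
      fix x :: real
      obtain n where "x < of_nat n"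
        using reals_Archimedean2 by blast
      then show "x \<in> (\<Union>(?LT ` \<rat>))"
        by (auto intro: bexI[of _ "of_nat n"])
    qed simp
    show "emeasure ?D X \<noteq> \<infinity>" if "X \<in> ?LT ` \<rat>" for X
      using that fin by (auto simp: less_top)
    show "emeasure ?D X = emeasure ?R X" if "X \<in> ?E" for X
      using that D by auto
  qed
qed

lemma radial_integral:
  fixes f :: "real \<Rightarrow> real"
  assumes [measurable]: "f \<in> borel_measurable borel"
    and "(\<lambda>r. f r * r ^ (DIM('a) - 1)) absolutely_integrable_on {0<..}"
  shows "integrable lborel (\<lambda>z :: 'a::euclidean_space. f (norm z))"
    and "(LINT z|lborel. f (norm (z :: 'a))) =
           unit_ball_vol DIM('a) * DIM('a) * integral {0<..} (\<lambda>r. f r * r ^ (DIM('a) - 1))"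
proof -
  let ?n = "DIM('a)" and ?V = "unit_ball_vol DIM('a)"
  let ?\<rho> = "\<lambda>r::real. ?V * (?n * r ^ (?n - 1)) * indicator {0..} r"
  let ?g = "\<lambda>r. indicator {0<..} r * (f r * r ^ (?n - 1))"
  have "integrable lborel ?g"
    using assms(2) by (simp add: set_integrable_def integrable_completion)
  then have g: "integrable lborel (\<lambda>r::real. ?V * ?n * ?g r)"
    by (intro integrable_mult_right)
  have eq: "AE r::real in lborel. ?V * ?n * ?g r = ?\<rho> r * f r"
    by (rule AE_mp[OF AE_lborel_singleton[of 0]], rule AE_I2) (auto simp: indicator_def)
  have distr: "distr (lborel :: 'a measure) borel norm = density lborel ?\<rho>"
    unfolding distr_norm_lborel
    by (intro density_cong) (auto simp: indicator_def)
  have "integrable (density lborel ?\<rho>) f"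
    using integrable_cong_AE_imp[OF g _ eq] by (subst integrable_real_density) (auto intro!: AE_I2 split: split_indicator)
  then show "integrable lborel (\<lambda>z :: 'a. f (norm z))"
    unfolding distr[symmetric] by (simp add: integrable_distr_eq)
  have "(LINT z|lborel. f (norm (z :: 'a))) = integral\<^sup>L (distr lborel borel (norm :: 'a \<Rightarrow> real)) f"
    by (simp add: integral_distr)
  also have "\<dots> = (LINT r|lborel. ?\<rho> r * f r)"
    unfolding distr by (subst integral_real_density) (auto intro!: AE_I2 split: split_indicator)
  also have "\<dots> = (LINT r|lborel. ?V * ?n * ?g r)"
    by (intro integral_cong_AE AE_symmetric[OF eq]) auto
  also have "\<dots> = ?V * ?n * (LINT r|lebesgue. ?g r)"
    by (simp add: integral_completion)
  also have "(LINT r|lebesgue. ?g r) = integral {0<..} (\<lambda>r. f r * r ^ (?n - 1))"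
    using set_lebesgue_integral_eq_integral(2)[OF assms(2)]
    by (simp add: set_lebesgue_integral_def)
  finally show "(LINT z|lborel. f (norm (z :: 'a))) =
           ?V * ?n * integral {0<..} (\<lambda>r. f r * r ^ (?n - 1))" .
qed

text \<open>
  In the compactified radial variable \<open>v = |z|\<^sup>2 / (t\<^sup>2 + |z|\<^sup>2)\<close> a radial integral is an integral of
  Beta type: \<open>v\<^sup>a\<^sup>-\<^sup>1\<close> comes from the volume element and \<open>(1 - v)\<^sup>-\<^sup>a\<^sup>-\<^sup>1\<close> from the compression at infinity.
\<close>

lemma radial_integral_unit_interval:
  fixes g :: "real \<Rightarrow> real"
  defines "a \<equiv> real DIM('a::euclidean_space) / 2"
  assumes [measurable]: "g \<in> borel_measurable borel" and t: "t > 0"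
    and abs: "(\<lambda>v. g v * (v powr (a - 1) * (1 - v) powr (- a - 1))) absolutely_integrable_on {0<..<1}"
    and J: "((\<lambda>v. g v * (v powr (a - 1) * (1 - v) powr (- a - 1))) has_integral J) {0<..<1}"
  shows "integrable lborel (\<lambda>z :: 'a. g ((norm z)\<^sup>2 / (t\<^sup>2 + (norm z)\<^sup>2)))"
    and "(LINT z|lborel. g ((norm (z :: 'a))\<^sup>2 / (t\<^sup>2 + (norm z)\<^sup>2))) =
           pi powr a / Gamma a * t ^ DIM('a) * J"
proof -
  let ?n = "DIM('a)"
  let ?f = "\<lambda>r. g (r\<^sup>2 / (t\<^sup>2 + r\<^sup>2))"
  \<comment> \<open>The inverse of \<open>r \<mapsto> r\<^sup>2 / (t\<^sup>2 + r\<^sup>2)\<close>, and its derivative.\<close>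
  let ?\<phi> = "\<lambda>v. t * v powr (1 / 2) * (1 - v) powr (- 1 / 2)"
  let ?\<phi>' = "\<lambda>v. t / 2 * v powr (- 1 / 2) * (1 - v) powr (- 3 / 2)"
  have n: "?n > 0"
    by simp
  have \<phi>: "?\<phi> v > 0" "(?\<phi> v)\<^sup>2 / (t\<^sup>2 + (?\<phi> v)\<^sup>2) = v" if "v \<in> {0<..<1}" for v
  proof -
    have "(1 - v) powr (- 1 / 2) = 1 / sqrt (1 - v)"
      using that powr_minus_divide[of "1 - v" "1 / 2"] by (simp add: powr_half_sqrt)
    then have "(?\<phi> v)\<^sup>2 = t\<^sup>2 * (v / (1 - v))"
      using that by (simp add: power_mult_distrib powr_half_sqrt power_divide)
    moreover have "t\<^sup>2 + t\<^sup>2 * (v / (1 - v)) = t\<^sup>2 / (1 - v)"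
      using that by (simp add: field_simps)
    ultimately show "(?\<phi> v)\<^sup>2 / (t\<^sup>2 + (?\<phi> v)\<^sup>2) = v"
      using that t by simp
    show "?\<phi> v > 0"
      using that t by simp
  qed
  have inj: "inj_on ?\<phi> {0<..<1}"
    using \<phi>(2) by (intro inj_on_inverseI[where g = "\<lambda>r. r\<^sup>2 / (t\<^sup>2 + r\<^sup>2)"])
  have img: "?\<phi> ` {0<..<1} = {0<..}"
  proof (intro equalityI subsetI)
    fix r :: real
    assume "r \<in> {0<..}"
    then have r: "r > 0" by simp
    let ?v = "r\<^sup>2 / (t\<^sup>2 + r\<^sup>2)"
    have v: "?v \<in> {0<..<1}" and 1: "1 - ?v = t\<^sup>2 / (t\<^sup>2 + r\<^sup>2)"
      using r t by (auto simp: field_simps add_pos_pos)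
    have "?v powr (1 / 2) = r / sqrt (t\<^sup>2 + r\<^sup>2)"
      using r by (simp add: powr_half_sqrt real_sqrt_divide)
    moreover have "(1 - ?v) powr (- 1 / 2) = sqrt (t\<^sup>2 + r\<^sup>2) / t"
      unfolding 1 using t powr_minus_divide[of "t\<^sup>2 / (t\<^sup>2 + r\<^sup>2)" "1 / 2"]
      by (simp add: powr_half_sqrt real_sqrt_divide)
    moreover have "sqrt (t\<^sup>2 + r\<^sup>2) > 0"
      using t by (simp add: add_pos_nonneg)
    ultimately have "?\<phi> ?v = r"
      using t by simp
    show "r \<in> ?\<phi> ` {0<..<1}"
      by (rule image_eqI[OF _ v], rule sym) fact
  qed (use \<phi>(1) in auto)
  have der: "(?\<phi> has_real_derivative ?\<phi>' v) (at v within {0<..<1})" if "v \<in> {0<..<1}" for v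
  proof -
    have eq: "v powr (1 / 2) = v powr (- 1 / 2) * v" "(1 - v) powr (- 1 / 2) = (1 - v) powr (- 3 / 2) * (1 - v)"
      using that powr_add[of v "- 1 / 2" 1] powr_add[of "1 - v" "- 3 / 2" 1] by simp_all
    have "(?\<phi> has_real_derivative t * v powr (1 / 2) * (1 / 2 * (1 - v) powr (- 3 / 2))
             + t * (1 / 2 * v powr (- 1 / 2)) * (1 - v) powr (- 1 / 2)) (at v within {0<..<1})"
    proof (intro DERIV_mult' DERIV_cmult)
      show "((\<lambda>v. v powr (1 / 2)) has_real_derivative 1 / 2 * v powr (- 1 / 2)) (at v within {0<..<1})"
        using that has_real_derivative_powr[of v "1 / 2"] by (simp add: has_field_derivative_at_within)
      have "((\<lambda>v. (1 - v) powr (- 1 / 2)) has_real_derivative (- 1 / 2 * (1 - v) powr (- 1 / 2 - 1)) * (- 1)) (at v)"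
        using that by (intro DERIV_chain2[where f = "\<lambda>v. v powr (- 1 / 2)" and g = "\<lambda>v. 1 - v"] has_real_derivative_powr)
          (auto intro!: derivative_eq_intros)
      then show "((\<lambda>v. (1 - v) powr (- 1 / 2)) has_real_derivative 1 / 2 * (1 - v) powr (- 3 / 2)) (at v within {0<..<1})"
        by (simp add: has_field_derivative_at_within)
    qed
    also have "t * v powr (1 / 2) * (1 / 2 * (1 - v) powr (- 3 / 2))
             + t * (1 / 2 * v powr (- 1 / 2)) * (1 - v) powr (- 1 / 2) = ?\<phi>' v"
      unfolding eq by (simp add: algebra_simps)
    finally show ?thesis .
  qed
  have jac: "t ^ ?n / 2 * (g v * (v powr (a - 1) * (1 - v) powr (- a - 1))) =
               \<bar>?\<phi>' v\<bar> * (?f (?\<phi> v) * ?\<phi> v ^ (?n - 1))" if v: "v \<in> {0<..<1}" for v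
  proof -
    have e: "real (?n - 1) * (1 / 2) = a - 1 / 2" "real (?n - 1) * (- 1 / 2) = 1 / 2 - a"
      using n by (simp_all add: a_def of_nat_diff field_simps)
    have "(v powr (1 / 2)) ^ (?n - 1) = v powr (a - 1 / 2)"
        "((1 - v) powr (- 1 / 2)) ^ (?n - 1) = (1 - v) powr (1 / 2 - a)"
      using v by (subst powr_power; (simp only: e)?; simp)+
    then have "?\<phi> v ^ (?n - 1) = t ^ (?n - 1) * v powr (a - 1 / 2) * (1 - v) powr (1 / 2 - a)"
      by (simp only: power_mult_distrib)
    then have "\<bar>?\<phi>' v\<bar> * (?f (?\<phi> v) * ?\<phi> v ^ (?n - 1)) =
        (t * t ^ (?n - 1)) / 2 * (g v * ((v powr (- 1 / 2) * v powr (a - 1 / 2)) *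
        ((1 - v) powr (- 3 / 2) * (1 - v) powr (1 / 2 - a))))"
      using v t unfolding \<phi>(2)[OF v] by (simp add: abs_mult)
    also have "v powr (- 1 / 2) * v powr (a - 1 / 2) = v powr (a - 1)"
      unfolding powr_add[symmetric] by (rule arg_cong[where f = "(powr) v"]) simp
    also have "(1 - v) powr (- 3 / 2) * (1 - v) powr (1 / 2 - a) = (1 - v) powr (- a - 1)"
      unfolding powr_add[symmetric] by (rule arg_cong[where f = "(powr) (1 - v)"]) simp
    also have "t * t ^ (?n - 1) = t ^ ?n"
      using n by (metis Suc_diff_1 power_Suc)
    finally show ?thesis
      by simp
  qed
  have "(\<lambda>v. \<bar>?\<phi>' v\<bar> * (?f (?\<phi> v) * ?\<phi> v ^ (?n - 1))) absolutely_integrable_on {0<..<1} \<and>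
      integral {0<..<1} (\<lambda>v. \<bar>?\<phi>' v\<bar> * (?f (?\<phi> v) * ?\<phi> v ^ (?n - 1))) = t ^ ?n / 2 * J"
  proof
    show "(\<lambda>v. \<bar>?\<phi>' v\<bar> * (?f (?\<phi> v) * ?\<phi> v ^ (?n - 1))) absolutely_integrable_on {0<..<1}"
      by (rule absolutely_integrable_spike[OF set_integrable_mult_right[OF abs, of "t ^ ?n / 2"], of "{}"])
         (use jac in auto)
    show "integral {0<..<1} (\<lambda>v. \<bar>?\<phi>' v\<bar> * (?f (?\<phi> v) * ?\<phi> v ^ (?n - 1))) = t ^ ?n / 2 * J"
      by (rule integral_unique, rule has_integral_eq[OF _ has_integral_mult_right[OF J, of "t ^ ?n / 2"]])
         (use jac in auto)
  qed
  then have "(\<lambda>r. ?f r * r ^ (?n - 1)) absolutely_integrable_on (?\<phi> ` {0<..<1}) \<and>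
      integral (?\<phi> ` {0<..<1}) (\<lambda>r. ?f r * r ^ (?n - 1)) = t ^ ?n / 2 * J"
    by (rule has_absolute_integral_change_of_variables_1'[where f = "\<lambda>r. ?f r * r ^ (?n - 1)"
              and g = ?\<phi> and g' = ?\<phi>', THEN iffD1, rotated 3])
       (simp, erule der, rule inj)
  then have *: "(\<lambda>r. ?f r * r ^ (?n - 1)) absolutely_integrable_on {0<..}"
      "integral {0<..} (\<lambda>r. ?f r * r ^ (?n - 1)) = t ^ ?n / 2 * J"
    unfolding img by auto
  have f: "?f \<in> borel_measurable borel"
    by simp
  show "integrable lborel (\<lambda>z :: 'a. g ((norm z)\<^sup>2 / (t\<^sup>2 + (norm z)\<^sup>2)))"
    by (rule radial_integral(1)[OF f *(1)])
  have "Gamma (a + 1) = a * Gamma a"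
    unfolding a_def using n nonpos_Ints_nonpos[of "?n / 2 :: real"] by (intro Gamma_plus1) force
  then have "unit_ball_vol ?n * ?n = 2 * (pi powr a / Gamma a)"
    using n by (simp add: unit_ball_vol_def a_def[symmetric]) (simp add: a_def)
  then show "(LINT z|lborel. g ((norm (z :: 'a))\<^sup>2 / (t\<^sup>2 + (norm z)\<^sup>2))) =
           pi powr a / Gamma a * t ^ DIM('a) * J"
    unfolding radial_integral(2)[OF f *(1)] *(2) by simp
qed

section \<open>Radial integrals of the bubble\<close>

lemma square_powr_half:
  fixes x :: real
  assumes "x > 0"
  shows "(x\<^sup>2) powr (real n / 2) = x ^ n"
proof -
  have "(x\<^sup>2) powr (real n / 2) = (x powr 2) powr (real n / 2)"
    using assms by simp
  also have "\<dots> = x powr real n"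
    unfolding powr_powr by simp
  finally show ?thesis
    using assms by (simp add: powr_realpow)
qed

text \<open>
  The same substitution for functions of \<open>t\<^sup>2 + |z|\<^sup>2 = t\<^sup>2 / (1 - v)\<close>.
\<close>

lemma integral_radial_quadratic:
  fixes h :: "real \<Rightarrow> real"
  defines "a \<equiv> real DIM('a::euclidean_space) / 2"
  assumes "h \<in> borel_measurable borel" and t: "t > 0"
    and "(\<lambda>v. h (t\<^sup>2 / (1 - v)) * (v powr (a - 1) * (1 - v) powr (- a - 1))) absolutely_integrable_on {0<..<1}"
    and "((\<lambda>v. h (t\<^sup>2 / (1 - v)) * (v powr (a - 1) * (1 - v) powr (- a - 1))) has_integral J) {0<..<1}"
  shows "integrable lborel (\<lambda>z :: 'a. h (t\<^sup>2 + (norm z)\<^sup>2))"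
    and "(LINT z|lborel. h (t\<^sup>2 + (norm (z :: 'a))\<^sup>2)) = pi powr a / Gamma a * t ^ DIM('a) * J"
proof -
  have [measurable]: "h \<in> borel_measurable borel" by fact
  have eq: "t\<^sup>2 / (1 - (norm z)\<^sup>2 / (t\<^sup>2 + (norm z)\<^sup>2)) = t\<^sup>2 + (norm z)\<^sup>2" for z :: 'a
  proof -
    have "t\<^sup>2 + (norm z)\<^sup>2 > 0"
      using t by (simp add: add_pos_nonneg)
    then show ?thesis
      using t by (simp add: divide_simps)
  qed
  note * = radial_integral_unit_interval[where 'a = 'a, of "\<lambda>v. h (t\<^sup>2 / (1 - v))", folded a_def, OF _ t assms(4,5), unfolded eq]
  show "integrable lborel (\<lambda>z :: 'a. h (t\<^sup>2 + (norm z)\<^sup>2))"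
    by (rule *(1)) measurable
  show "(LINT z|lborel. h (t\<^sup>2 + (norm (z :: 'a))\<^sup>2)) = pi powr a / Gamma a * t ^ DIM('a) * J"
    by (rule *(2)) measurable
qed

lemma integrable_quadratic_powr:
  assumes t: "t > 0" and p: "p > real DIM('a::euclidean_space) / 2"
  shows "integrable lborel (\<lambda>z :: 'a. (t\<^sup>2 + (norm z)\<^sup>2) powr (- p))"
proof -
  let ?a = "real DIM('a) / 2"
  have eq: "(t\<^sup>2) powr (- p) * (v powr (?a - 1) * (1 - v) powr (p - ?a - 1)) =
      (t\<^sup>2 / (1 - v)) powr (- p) * (v powr (?a - 1) * (1 - v) powr (- ?a - 1))"
    if "v \<in> {0<..<1}" for v
  proof -
    have "(1 - v) powr (p - ?a - 1) = (1 - v) powr p * (1 - v) powr (- ?a - 1)"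
      unfolding powr_add[symmetric] by (rule arg_cong[where f = "(powr) (1 - v)"]) simp
    moreover have "(t\<^sup>2 / (1 - v)) powr (- p) = (t\<^sup>2) powr (- p) * (1 - v) powr p"
      using that t by (simp add: powr_divide powr_minus_divide)
    ultimately show ?thesis
      by simp
  qed
  have a: "?a > 0" and pa: "p - ?a > 0"
    using p by simp_all
  note B = absolutely_integrable_Beta_Ioo[OF a pa] has_integral_Beta_Ioo[OF a pa]
  show ?thesis
  proof (rule integral_radial_quadratic(1)[OF _ t])
    show "(\<lambda>v. (t\<^sup>2 / (1 - v)) powr (- p) * (v powr (?a - 1) * (1 - v) powr (- ?a - 1)))
        absolutely_integrable_on {0<..<1}"
      by (rule absolutely_integrable_eq[OF set_integrable_mult_right[OF B(1), of "(t\<^sup>2) powr (- p)"], OF eq])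
    show "((\<lambda>v. (t\<^sup>2 / (1 - v)) powr (- p) * (v powr (?a - 1) * (1 - v) powr (- ?a - 1)))
        has_integral (t\<^sup>2) powr (- p) * Beta ?a (p - ?a)) {0<..<1}"
      by (rule has_integral_eq[OF eq has_integral_mult_right[OF B(2), of "(t\<^sup>2) powr (- p)"]])
  qed measurable
qed

text \<open>
  The squared bubble, which is the \<open>N\<close>-th power of \<open>t / (t\<^sup>2 + |z|\<^sup>2) = (1 - v) / t\<close>, makes the radial
  density symmetric under \<open>v \<mapsto> 1 - v\<close>.
\<close>

lemma bubble_density:
  assumes t: "t > 0" and v: "v \<in> {0<..<1}" and n: "n > 0"
  shows "(t / (t\<^sup>2 / (1 - v))) powr real n * (v powr (real n / 2 - 1) * (1 - v) powr (- (real n / 2) - 1)) =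
           1 / t ^ n * (v powr (real n / 2 - 1) * (1 - v) powr (real n / 2 - 1))"
proof -
  have "(1 - v) powr (real n / 2 - 1) = (1 - v) powr n * (1 - v) powr (- (real n / 2) - 1)"
    unfolding powr_add[symmetric] by (rule arg_cong[where f = "(powr) (1 - v)"]) simp
  moreover have "t / (t\<^sup>2 / (1 - v)) = (1 - v) / t"
    using t v by (simp add: power2_eq_square)
  ultimately show ?thesis
    using t v n by (simp add: powr_divide powr_realpow)
qed

text \<open>
  The scale drops out because the squared bubble is \<open>t\<^sup>-\<^sup>N\<close> times a fixed function of \<open>z / t\<close>.
\<close>

lemma bubble_mass:
  fixes t :: real
  defines "a \<equiv> real DIM('a::euclidean_space) / 2"
  assumes t: "t > 0"
  shows "integrable lborel (\<lambda>z :: 'a. (t / (t\<^sup>2 + (norm z)\<^sup>2)) powr DIM('a))"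
    and "(LINT z|lborel. (t / (t\<^sup>2 + (norm (z :: 'a))\<^sup>2)) powr DIM('a)) = pi powr a / Gamma a * Beta a a"
proof -
  have a: "a > 0"
    by (simp add: a_def)
  note eq = bubble_density[OF t _ DIM_positive[where 'a = 'a], folded a_def, symmetric]
  have 1: "(\<lambda>v. (t / (t\<^sup>2 / (1 - v))) powr DIM('a) * (v powr (a - 1) * (1 - v) powr (- a - 1)))
      absolutely_integrable_on {0<..<1}"
    by (rule absolutely_integrable_eq[OF set_integrable_mult_right[OF
            absolutely_integrable_Beta_Ioo[OF a a], of "1 / t ^ DIM('a)"], OF eq])
  have 2: "((\<lambda>v. (t / (t\<^sup>2 / (1 - v))) powr DIM('a) * (v powr (a - 1) * (1 - v) powr (- a - 1)))
      has_integral 1 / t ^ DIM('a) * Beta a a) {0<..<1}"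
    by (rule has_integral_eq[OF eq has_integral_mult_right[OF has_integral_Beta_Ioo[OF a a]]])
  note * = integral_radial_quadratic[where 'a = 'a, folded a_def,
      of "\<lambda>q. (t / q) powr DIM('a)", OF _ t 1 2]
  show "integrable lborel (\<lambda>z :: 'a. (t / (t\<^sup>2 + (norm z)\<^sup>2)) powr DIM('a))"
    by (rule *(1)) measurable
  have "(LINT z|lborel. (t / (t\<^sup>2 + (norm (z :: 'a))\<^sup>2)) powr DIM('a)) =
      pi powr a / Gamma a * t ^ DIM('a) * (1 / t ^ DIM('a) * Beta a a)"
    by (rule *(2)) measurable
  then show "(LINT z|lborel. (t / (t\<^sup>2 + (norm (z :: 'a))\<^sup>2)) powr DIM('a)) = pi powr a / Gamma a * Beta a a"
    using t by simp
qed

text \<open>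
  Since \<open>ln (w z) = ln (1 - v) - ln t\<close>, this is the Beta integral with a logarithm.
\<close>

lemma bubble_entropy:
  fixes t :: real
  defines "a \<equiv> real DIM('a::euclidean_space) / 2"
  assumes t: "t > 0"
  defines "w \<equiv> \<lambda>z :: 'a. t / (t\<^sup>2 + (norm z)\<^sup>2)"
  shows "integrable lborel (\<lambda>z. w z powr DIM('a) * ln (w z))"
    and "(LINT z|lborel. w z powr DIM('a) * ln (w z)) =
           pi powr a / Gamma a * Beta a a * (Digamma a - Digamma (2 * a) - ln t)"
proof -
  have a: "a > 0"
    by (simp add: a_def)
  let ?\<beta> = "\<lambda>v. v powr (a - 1) * (1 - v) powr (a - 1)"
  have eq: "1 / t ^ DIM('a) * (?\<beta> v * ln (1 - v) - ln t * ?\<beta> v) =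
      (t / (t\<^sup>2 / (1 - v))) powr DIM('a) * ln (t / (t\<^sup>2 / (1 - v))) * (v powr (a - 1) * (1 - v) powr (- a - 1))"
    if "v \<in> {0<..<1}" for v
  proof -
    have "t / (t\<^sup>2 / (1 - v)) = (1 - v) / t"
      using t that by (simp add: power2_eq_square)
    then have "ln (t / (t\<^sup>2 / (1 - v))) = ln (1 - v) - ln t"
      using that t by (simp add: ln_div)
    then have "(t / (t\<^sup>2 / (1 - v))) powr DIM('a) * ln (t / (t\<^sup>2 / (1 - v))) * (v powr (a - 1) * (1 - v) powr (- a - 1)) =
       ((t / (t\<^sup>2 / (1 - v))) powr DIM('a) * (v powr (a - 1) * (1 - v) powr (- a - 1))) * (ln (1 - v) - ln t)"
      by simp
    also have "\<dots> = (1 / t ^ DIM('a) * ?\<beta> v) * (ln (1 - v) - ln t)"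
      using bubble_density[OF t that DIM_positive[where 'a = 'a], folded a_def] by simp
    finally show ?thesis
      by (simp only: left_diff_distrib right_diff_distrib mult_ac)
  qed
  have 1: "(\<lambda>v. (t / (t\<^sup>2 / (1 - v))) powr DIM('a) * ln (t / (t\<^sup>2 / (1 - v))) *
      (v powr (a - 1) * (1 - v) powr (- a - 1))) absolutely_integrable_on {0<..<1}"
    by (rule absolutely_integrable_eq[OF set_integrable_mult_right[OF set_integral_diff(1)[OF
            absolutely_integrable_Beta_ln[OF a a] set_integrable_mult_right[OF absolutely_integrable_Beta_Ioo[OF a a]]],
            of "1 / t ^ DIM('a)" "ln t"], OF eq])
  have 2: "((\<lambda>v. (t / (t\<^sup>2 / (1 - v))) powr DIM('a) * ln (t / (t\<^sup>2 / (1 - v))) *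
      (v powr (a - 1) * (1 - v) powr (- a - 1))) has_integral
      1 / t ^ DIM('a) * (Beta a a * (Digamma a - Digamma (a + a)) - ln t * Beta a a)) {0<..<1}"
    by (rule has_integral_eq[OF eq has_integral_mult_right[OF has_integral_diff[OF has_integral_Beta_ln[OF a a]
            has_integral_mult_right[OF has_integral_Beta_Ioo[OF a a]]]]])
  note * = integral_radial_quadratic[where 'a = 'a, folded a_def,
      of "\<lambda>q. (t / q) powr DIM('a) * ln (t / q)", OF _ t 1 2, folded w_def]
  show "integrable lborel (\<lambda>z. w z powr DIM('a) * ln (w z))"
    unfolding w_def by (rule *(1)) measurable
  have "(LINT z|lborel. w z powr DIM('a) * ln (w z)) = pi powr a / Gamma a * t ^ DIM('a) *
      (1 / t ^ DIM('a) * (Beta a a * (Digamma a - Digamma (a + a)) - ln t * Beta a a))"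
    unfolding w_def by (rule *(2)) measurable
  then show "(LINT z|lborel. w z powr DIM('a) * ln (w z)) =
           pi powr a / Gamma a * Beta a a * (Digamma a - Digamma (2 * a) - ln t)"
    using t by (simp add: algebra_simps add_divide_distrib diff_divide_distrib)
qed

text \<open>
  The two terms are separately divergent at infinity. In the variable \<open>v\<close> they combine to the
  integrand of Gauss's formula and that of \<open>cutoff_integral\<close>, with the cut at the value \<open>c\<close> of \<open>v\<close>
  on the sphere of radius \<open>R\<close>.
\<close>

lemma cutoff_bubble:
  fixes t R :: real
  defines "a \<equiv> real DIM('a::euclidean_space) / 2"
  assumes t: "t > 0" and R: "R > 0"
  defines "k \<equiv> \<lambda>z :: 'a. indicator {R<..} (norm z) / norm z ^ DIM('a) - (t\<^sup>2 + (norm z)\<^sup>2) powr (- a)"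
  shows "integrable lborel k"
    and "(LINT z|lborel. k z) = pi powr a / Gamma a * (Digamma a + euler_mascheroni + 2 * ln (t / R))"
proof -
  have a: "a > 0"
    by (simp add: a_def)
  define c where "c = R\<^sup>2 / (t\<^sup>2 + R\<^sup>2)"
  have pos: "t\<^sup>2 + R\<^sup>2 > 0"
    using t by (simp add: add_pos_nonneg)
  have c1: "1 - c = t\<^sup>2 / (t\<^sup>2 + R\<^sup>2)"
    using pos t diff_divide_distrib[of "t\<^sup>2 + R\<^sup>2" "R\<^sup>2" "t\<^sup>2 + R\<^sup>2"] by (simp add: c_def)
  have "c > 0"
    unfolding c_def using pos R by (intro divide_pos_pos) auto
  moreover have "1 - c > 0"
    unfolding c1 using pos t by (intro divide_pos_pos) auto
  moreover have "(1 - c) / c = (t / R)\<^sup>2"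
    unfolding c1 unfolding c_def using pos by (simp only: power_divide) simp
  ultimately have c: "0 < c" "c < 1" "(1 - c) / c = (t / R)\<^sup>2"
    by simp_all
  let ?h = "\<lambda>q. indicator {t\<^sup>2 + R\<^sup>2<..} q / (q - t\<^sup>2) powr a - q powr (- a)"
  let ?f = "\<lambda>v. 1 / t ^ DIM('a) * ((indicator {c<..} v / v - 1) / (1 - v) + (1 - v powr (a - 1)) / (1 - v))"
  have eq: "?f v = ?h (t\<^sup>2 / (1 - v)) * (v powr (a - 1) * (1 - v) powr (- a - 1))" if v: "v \<in> {0<..<1}" for v
  proof -
    have ind: "indicator {t\<^sup>2 + R\<^sup>2<..} (t\<^sup>2 / (1 - v)) = (indicator {c<..} v :: real)"
    proof -
      have "c < v \<longleftrightarrow> R\<^sup>2 < v * (t\<^sup>2 + R\<^sup>2)"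
        using pos by (simp add: c_def pos_divide_less_eq)
      moreover have "t\<^sup>2 + R\<^sup>2 < t\<^sup>2 / (1 - v) \<longleftrightarrow> (t\<^sup>2 + R\<^sup>2) * (1 - v) < t\<^sup>2"
        using v by (simp add: pos_less_divide_eq)
      ultimately have "t\<^sup>2 + R\<^sup>2 < t\<^sup>2 / (1 - v) \<longleftrightarrow> c < v"
        by (simp add: algebra_simps)
      then show ?thesis
        by (simp add: indicator_def)
    qed
    have tn: "(t\<^sup>2) powr a = t ^ DIM('a)"
      unfolding a_def using t by (rule square_powr_half)
    have "t\<^sup>2 / (1 - v) - t\<^sup>2 = t\<^sup>2 * (v / (1 - v))"
      using v by (simp add: field_simps)
    then have 1: "(t\<^sup>2 / (1 - v) - t\<^sup>2) powr a = t ^ DIM('a) * (v powr a / (1 - v) powr a)"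
      using v t by (simp add: powr_mult powr_divide tn)
    have 2: "(t\<^sup>2 / (1 - v)) powr (- a) = (1 - v) powr a / t ^ DIM('a)"
      using v t by (simp add: powr_minus_divide powr_divide tn)
    have 3: "v powr (a - 1) = v powr a / v" "(1 - v) powr (- a - 1) = 1 / ((1 - v) powr a * (1 - v))"
      using v by (simp_all add: powr_diff powr_minus_divide)
    have alg: "1 / T * ((I / x - 1) / y + (1 - p / x) / y) = (I / (T * (p / q)) - q / T) * (p / x * (1 / (q * y)))"
      if "x \<noteq> 0" "y \<noteq> 0" "T \<noteq> 0" "p \<noteq> 0" "q \<noteq> 0" for I x y T p q :: real
      using that by (simp add: left_diff_distrib diff_divide_distrib add_divide_distrib right_diff_distrib distrib_left)
    show ?thesis
      unfolding ind 1 2 3 using v t by (intro alg) auto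
  qed
  note i1 = cutoff_integral[OF c(1,2)] and i2 = Digamma_Gauss_integral[OF a]
  have 1: "(\<lambda>v. ?h (t\<^sup>2 / (1 - v)) * (v powr (a - 1) * (1 - v) powr (- a - 1))) absolutely_integrable_on {0<..<1}"
    by (rule absolutely_integrable_eq[OF set_integrable_mult_right[OF set_integral_add(1)[OF i1(1) i2(1)]] eq])
  have 2: "((\<lambda>v. ?h (t\<^sup>2 / (1 - v)) * (v powr (a - 1) * (1 - v) powr (- a - 1))) has_integral
      1 / t ^ DIM('a) * (ln ((1 - c) / c) + (Digamma a + euler_mascheroni))) {0<..<1}"
    by (rule has_integral_eq[OF eq has_integral_mult_right[OF has_integral_add[OF i1(2) i2(2)]]])
  have k: "?h (t\<^sup>2 + (norm z)\<^sup>2) = k z" for z :: 'a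
  proof (cases "norm z > R")
    case True
    with R have "((norm z)\<^sup>2) powr a = norm z ^ DIM('a)"
      unfolding a_def by (intro square_powr_half) auto
    with True R show ?thesis
      by (simp add: k_def power_strict_mono)
  next
    case False
    then have "(norm z)\<^sup>2 \<le> R\<^sup>2"
      by (intro power_mono) auto
    with False show ?thesis
      by (simp add: k_def)
  qed
  note * = integral_radial_quadratic[where 'a = 'a, folded a_def, of ?h, OF _ t 1 2, unfolded k]
  show "integrable lborel k"
    by (rule *(1)) measurable
  have "(LINT z|lborel. k z) = pi powr a / Gamma a * t ^ DIM('a) *
      (1 / t ^ DIM('a) * (ln ((1 - c) / c) + (Digamma a + euler_mascheroni)))"
    by (rule *(2)) measurable
  also have "ln ((1 - c) / c) = 2 * ln (t / R)"
    unfolding c(3) using t R by (simp add: ln_realpow)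
  finally show "(LINT z|lborel. k z) = pi powr a / Gamma a * (Digamma a + euler_mascheroni + 2 * ln (t / R))"
    using t by (simp add: algebra_simps)
qed

section \<open>Invariance of the scale-invariant measure under inversion\<close>

lemma nn_integral_lborel_scaleR:
  fixes f :: "'a::euclidean_space \<Rightarrow> ennreal"
  assumes [measurable]: "f \<in> borel_measurable borel" and c: "c > 0"
  shows "(\<integral>\<^sup>+z. f z \<partial>lborel) = (\<integral>\<^sup>+z. ennreal (c ^ DIM('a)) * f (c *\<^sub>R z) \<partial>lborel)"
  by (subst lborel_affine[of c 0])
     (use c in \<open>auto simp: nn_integral_density nn_integral_distr\<close>)

lemma nn_integral_dilation:
  fixes f :: "'a::euclidean_space \<Rightarrow> ennreal"
  assumes [measurable]: "f \<in> borel_measurable borel" and c: "c > 0"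
  shows "(\<integral>\<^sup>+z. f z * ennreal (1 / norm z ^ DIM('a)) \<partial>lborel) =
         (\<integral>\<^sup>+z. f (c *\<^sub>R z) * ennreal (1 / norm z ^ DIM('a)) \<partial>lborel)"
proof -
  have "ennreal (c ^ DIM('a)) * (f (c *\<^sub>R z) * ennreal (1 / norm (c *\<^sub>R z) ^ DIM('a))) =
        f (c *\<^sub>R z) * ennreal (1 / norm z ^ DIM('a))" for z :: 'a
  proof -
    have "ennreal (c ^ DIM('a)) * ennreal (1 / norm (c *\<^sub>R z) ^ DIM('a)) = ennreal (1 / norm z ^ DIM('a))"
      using c by (simp add: power_mult_distrib flip: ennreal_mult'')
    then show ?thesis
      by (metis mult.left_commute)
  qed
  then show ?thesis
    by (subst nn_integral_lborel_scaleR[OF _ c]) auto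
qed

text \<open>
  The measure \<open>|z|\<^sup>-\<^sup>N dz\<close> is invariant under dilations, so an integral against it can be replaced by
  one over a fixed shell of the integrals along the dilation orbits \<open>s \<mapsto> e\<^sup>s z\<close>: insert
  the integral \<open>1\<close> of the indicator of \<open>0 < ln |z| - s < 1\<close> over \<open>s\<close>, exchange the order of integration, and
  dilate by \<open>e\<^sup>s\<close> for each \<open>s\<close>. This is polar integration without measures on the sphere.
\<close>

lemma nn_integral_dilation_average:
  fixes f :: "'a::euclidean_space \<Rightarrow> ennreal"
  assumes [measurable]: "f \<in> borel_measurable borel"
  shows "(\<integral>\<^sup>+z. f z * ennreal (1 / norm z ^ DIM('a)) \<partial>lborel) =
         (\<integral>\<^sup>+z. indicator {0<..<1} (ln (norm z)) * ennreal (1 / norm z ^ DIM('a)) *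
                (\<integral>\<^sup>+s. f (exp s *\<^sub>R z) \<partial>lborel) \<partial>lborel)"
proof -
  let ?w = "\<lambda>z :: 'a. ennreal (1 / norm z ^ DIM('a))"
  let ?I = "indicator {0<..<1} :: real \<Rightarrow> ennreal"
  have one: "(\<integral>\<^sup>+s. ?I (ln (norm z) - s) \<partial>lborel) = 1" for z :: 'a
  proof -
    have "(\<integral>\<^sup>+s. ?I (ln (norm z) - s) \<partial>lborel) = (\<integral>\<^sup>+s. indicator {ln (norm z) - 1<..<ln (norm z)} s \<partial>lborel)"
      by (intro nn_integral_cong) (auto split: split_indicator)
    then show ?thesis
      by simp
  qed
  have "(\<integral>\<^sup>+z. f z * ?w z \<partial>lborel) = (\<integral>\<^sup>+z. (\<integral>\<^sup>+s. f z * ?I (ln (norm z) - s) * ?w z \<partial>lborel) \<partial>lborel)"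
    by (simp add: nn_integral_cmult nn_integral_multc one)
  also have "\<dots> = (\<integral>\<^sup>+s. (\<integral>\<^sup>+z. f z * ?I (ln (norm z) - s) * ?w z \<partial>lborel) \<partial>lborel)"
    by (rule lborel_pair.Fubini') measurable
  also have "\<dots> = (\<integral>\<^sup>+s. (\<integral>\<^sup>+z. f (exp s *\<^sub>R z) * ?I (ln (norm (exp s *\<^sub>R z)) - s) * ?w z \<partial>lborel) \<partial>lborel)"
    by (intro nn_integral_cong nn_integral_dilation[of "\<lambda>z. f z * ?I (ln (norm z) - _)"]) auto
  also have "\<dots> = (\<integral>\<^sup>+s. (\<integral>\<^sup>+z. ?I (ln (norm z)) * ?w z * f (exp s *\<^sub>R z) \<partial>lborel) \<partial>lborel)"
  proof (intro nn_integral_cong)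
    fix s :: real and z :: 'a
    show "f (exp s *\<^sub>R z) * ?I (ln (norm (exp s *\<^sub>R z)) - s) * ?w z = ?I (ln (norm z)) * ?w z * f (exp s *\<^sub>R z)"
      by (cases "z = 0") (auto simp: ln_mult mult_ac)
  qed
  also have "\<dots> = (\<integral>\<^sup>+z. (\<integral>\<^sup>+s. ?I (ln (norm z)) * ?w z * f (exp s *\<^sub>R z) \<partial>lborel) \<partial>lborel)"
    by (rule lborel_pair.Fubini') measurable
  also have "\<dots> = (\<integral>\<^sup>+z. ?I (ln (norm z)) * ?w z * (\<integral>\<^sup>+s. f (exp s *\<^sub>R z) \<partial>lborel) \<partial>lborel)"
    by (intro nn_integral_cong nn_integral_cmult) auto
  finally show ?thesis .
qed

text \<open>
  Inversion in the sphere of radius \<open>sqrt A\<close> about the origin; \<open>A / 0 = 0\<close> makes the origin a fixed point.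
\<close>

definition inversion :: "real \<Rightarrow> 'a::euclidean_space \<Rightarrow> 'a" where
  "inversion A z = (A / (norm z)\<^sup>2) *\<^sub>R z"

lemma borel_measurable_inversion [measurable]: "inversion A \<in> borel_measurable borel"
  unfolding inversion_def[abs_def] by measurable

text \<open>
  On each dilation orbit the inversion acts as a reflection of the parameter \<open>s\<close>, so
  \<open>nn_integral_dilation_average\<close> makes the invariance a one-dimensional fact and no Jacobian determinant
  has to be computed.
\<close>

lemma nn_integral_inversion:
  fixes f :: "'a::euclidean_space \<Rightarrow> ennreal"
  assumes [measurable]: "f \<in> borel_measurable borel" and A: "A > 0"
  shows "(\<integral>\<^sup>+z. f (inversion A z) * ennreal (1 / norm z ^ DIM('a)) \<partial>lborel) =
         (\<integral>\<^sup>+z. f z * ennreal (1 / norm z ^ DIM('a)) \<partial>lborel)"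
proof -
  have orbit: "(\<integral>\<^sup>+s. f (inversion A (exp s *\<^sub>R z)) \<partial>lborel) = (\<integral>\<^sup>+s. f (exp s *\<^sub>R z) \<partial>lborel)"
    if z: "z \<noteq> 0" for z :: 'a
  proof -
    have "inversion A (exp s *\<^sub>R z) = exp (ln (A / (norm z)\<^sup>2) + (- 1) * s) *\<^sub>R z" for s
    proof -
      have "exp (ln (A / (norm z)\<^sup>2) + (- 1) * s) = A / (norm z)\<^sup>2 / exp s"
        using A z by (simp add: exp_diff)
      also have "\<dots> = A / (norm (exp s *\<^sub>R z))\<^sup>2 * exp s"
        by (simp add: power_mult_distrib power2_eq_square)
      finally show ?thesis
        by (simp add: inversion_def)
    qed
    then show ?thesis
      using nn_integral_real_affine[of "\<lambda>s. f (exp s *\<^sub>R z)" "- 1" "ln (A / (norm z)\<^sup>2)"] by simp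
  qed
  have "indicator {0<..<1} (ln (norm z)) * ennreal (1 / norm z ^ DIM('a)) *
                (\<integral>\<^sup>+s. f (inversion A (exp s *\<^sub>R z)) \<partial>lborel) =
        indicator {0<..<1} (ln (norm z)) * ennreal (1 / norm z ^ DIM('a)) *
                (\<integral>\<^sup>+s. f (exp s *\<^sub>R z) \<partial>lborel)" for z :: 'a
    using orbit[of z] by (cases "z = 0") auto
  then show ?thesis
    by (simp add: nn_integral_dilation_average)
qed

lemma integral_inversion:
  fixes f :: "'a::euclidean_space \<Rightarrow> real"
  assumes [measurable]: "f \<in> borel_measurable borel" and A: "A > 0"
  shows "integrable lborel (\<lambda>z. f (inversion A z) / norm z ^ DIM('a)) \<longleftrightarrow>
           integrable lborel (\<lambda>z. f z / norm z ^ DIM('a))" (is ?int)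
    and "(LINT z|lborel. f (inversion A z) / norm z ^ DIM('a)) =
           (LINT z|lborel. f z / norm z ^ DIM('a))" (is ?eq)
proof -
  define m :: "'a measure" where "m = density lborel (\<lambda>z. ennreal (1 / norm z ^ DIM('a)))"
  have m: "distr m borel (inversion A) = m"
  proof (rule measure_eqI)
    fix X :: "'a set"
    assume "X \<in> sets (distr m borel (inversion A))"
    then have [measurable]: "X \<in> sets borel"
      by simp
    have "emeasure (distr m borel (inversion A)) X = (\<integral>\<^sup>+z. indicator X z \<partial>distr m borel (inversion A))"
      by simp
    also have "\<dots> = (\<integral>\<^sup>+z. indicator X (inversion A z) * ennreal (1 / norm z ^ DIM('a)) \<partial>lborel)"
      unfolding m_def by (subst nn_integral_distr) (auto simp: nn_integral_density mult.commute)
    also have "\<dots> = (\<integral>\<^sup>+z. indicator X z * ennreal (1 / norm z ^ DIM('a)) \<partial>lborel)"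
      using A by (intro nn_integral_inversion) auto
    also have "\<dots> = emeasure m X"
      unfolding m_def by (simp add: emeasure_density mult.commute)
    finally show "emeasure (distr m borel (inversion A)) X = emeasure m X" .
  qed (simp add: m_def)
  have [measurable_cong]: "sets m = sets borel"
    by (simp add: m_def)
  have "integrable m (\<lambda>z. f (inversion A z)) \<longleftrightarrow> integrable m f"
    by (subst (2) m[symmetric]) (simp add: integrable_distr_eq)
  then show ?int
    unfolding m_def by (subst (asm) (1 2) integrable_density) auto
  have "(LINT z|m. f (inversion A z)) = (LINT z|m. f z)"
    by (subst (2) m[symmetric]) (simp add: integral_distr)
  then show ?eq
    unfolding m_def by (subst (asm) (1 2) integral_density) auto
qed

section \<open>Translations of quadratic powers\<close>

lemma lborel_reflect:
  fixes f :: "'a::euclidean_space \<Rightarrow> real"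
  assumes [measurable]: "f \<in> borel_measurable borel"
  shows "(LINT z|lborel. f (b - z)) = (LINT z|lborel. f z)"
proof -
  have "distr lborel borel (\<lambda>z. b + (- 1) *\<^sub>R z) = (lborel :: 'a measure)"
    using lborel_affine[of "- 1" b] by (simp add: density_1)
  then have "distr lborel borel (\<lambda>z. b - z) = (lborel :: 'a measure)"
    by simp
  then show ?thesis
    using integral_distr[of "\<lambda>z. b - z" lborel borel f] by simp
qed

lemma lborel_translate:
  fixes f :: "'a::euclidean_space \<Rightarrow> real"
  assumes [measurable]: "f \<in> borel_measurable borel"
  shows "integrable lborel (\<lambda>z. f (b + z)) \<longleftrightarrow> integrable lborel f"
    and "(LINT z|lborel. f (b + z)) = (LINT z|lborel. f z)"
  using integrable_distr_eq[of "(+) b" lborel borel f] integral_distr[of "(+) b" lborel borel f]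
  by (simp_all add: lborel_distr_plus)

text \<open>
  The integrand is odd under the reflection \<open>z \<mapsto> - b - z\<close> about \<open>- b / 2\<close>. In the application
  \<open>k\<close> is not integrable, so its two translates cannot be integrated separately.
\<close>

lemma integral_even_translate_diff:
  fixes k :: "'a::euclidean_space \<Rightarrow> real"
  assumes [measurable]: "k \<in> borel_measurable borel" and even: "\<And>z. k (- z) = k z"
  shows "(LINT z|lborel. k z - k (b + z)) = 0"
proof -
  have "k (- b - z) - k (b + (- b - z)) = - (k z - k (b + z))" for z
    using even[of z] even[of "b + z"] by (simp add: algebra_simps)
  then have "(LINT z|lborel. - (k z - k (b + z))) = (LINT z|lborel. k z - k (b + z))"
    using lborel_reflect[of "\<lambda>z. k z - k (b + z)" "- b"] by simp
  then show ?thesis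
    unfolding Bochner_Integration.integral_minus by linarith
qed

lemma powr_minus_Lipschitz:
  fixes p q m \<alpha> :: real
  assumes "m > 0" "\<alpha> > 0" "p \<ge> m" "q \<ge> m"
  shows "\<bar>p powr (- \<alpha>) - q powr (- \<alpha>)\<bar> \<le> \<alpha> * m powr (- \<alpha> - 1) * \<bar>p - q\<bar>"
proof -
  have "norm (p powr (- \<alpha>) - q powr (- \<alpha>)) \<le> \<alpha> * m powr (- \<alpha> - 1) * norm (p - q)"
  proof (rule field_differentiable_bound[where S = "{m..}" and f = "\<lambda>x. x powr (- \<alpha>)" and f' = "\<lambda>x. - \<alpha> * x powr (- \<alpha> - 1)"])
    show "((\<lambda>x. x powr (- \<alpha>)) has_field_derivative - \<alpha> * x powr (- \<alpha> - 1)) (at x within {m..})"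
      if "x \<in> {m..}" for x
      by (rule has_field_derivative_at_within, rule has_real_derivative_powr) (use that assms(1) in auto)
    show "norm (- \<alpha> * x powr (- \<alpha> - 1)) \<le> \<alpha> * m powr (- \<alpha> - 1)" if "x \<in> {m..}" for x
    proof -
      have "x powr (- \<alpha> - 1) \<le> m powr (- \<alpha> - 1)"
        using that assms(1,2) by (intro powr_mono2') auto
      then show ?thesis
        using assms(2) by (simp add: abs_mult)
    qed
  qed (use assms(3,4) in simp_all)
  then show ?thesis
    by simp
qed

lemma norm_square_le_translate:
  fixes b z :: "'a::real_normed_vector"
  shows "(norm z)\<^sup>2 \<le> 2 * (norm (b + z))\<^sup>2 + 2 * (norm b)\<^sup>2"
proof -
  have "norm z \<le> norm (b + z) + norm b"
    using norm_triangle_ineq4[of "b + z" b] by simp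
  then have "(norm z)\<^sup>2 \<le> (norm (b + z) + norm b)\<^sup>2"
    by (intro power_mono) auto
  also have "\<dots> \<le> 2 * (norm (b + z))\<^sup>2 + 2 * (norm b)\<^sup>2"
    using sum_squares_bound[of "norm (b + z)" "norm b"] by (simp add: power2_sum)
  finally show ?thesis .
qed

text \<open>
  Moving the centre changes the weight \<open>c + |z|\<^sup>2\<close> by a bounded factor at most. This gives
  all comparisons between decay measured from the origin and decay measured from another point.
\<close>

lemma quadratic_le_translate:
  fixes b z :: "'a::real_normed_vector"
  assumes t: "t > 0" and c: "c \<ge> 0"
  shows "c + (norm z)\<^sup>2 \<le> (2 + (c + 2 * (norm b)\<^sup>2) / t\<^sup>2) * (t\<^sup>2 + (norm (b + z))\<^sup>2)"
proof -
  define B where "B = (c + 2 * (norm b)\<^sup>2) / t\<^sup>2"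
  have B: "B * t\<^sup>2 = c + 2 * (norm b)\<^sup>2" "B \<ge> 0"
    using t c by (simp_all add: B_def)
  have "c + (norm z)\<^sup>2 \<le> 2 * (norm (b + z))\<^sup>2 + B * t\<^sup>2"
    unfolding B(1) using norm_square_le_translate[of z b] by simp
  also have "\<dots> \<le> 2 * t\<^sup>2 + 2 * (norm (b + z))\<^sup>2 + B * t\<^sup>2 + B * (norm (b + z))\<^sup>2"
    using B(2) by simp
  also have "\<dots> = (2 + B) * (t\<^sup>2 + (norm (b + z))\<^sup>2)"
    by (simp only: distrib_left distrib_right add.assoc)
  finally show ?thesis
    unfolding B_def .
qed

text \<open>
  The exponent \<open>- N / 2\<close> is the borderline of integrability at infinity. A translation changes
  \<open>t\<^sup>2 + |z|\<^sup>2\<close> by an amount of the order of its square root, so the difference gains an exponent \<open>1 / 2\<close> and is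
  integrable.
\<close>

lemma integrable_quadratic_powr_diff:
  fixes b :: "'a::euclidean_space"
  assumes t: "t > 0"
  defines "k \<equiv> \<lambda>z :: 'a. (t\<^sup>2 + (norm z)\<^sup>2) powr (- (real DIM('a) / 2))"
  shows "integrable lborel (\<lambda>z. k z - k (b + z))"
proof -
  let ?a = "real DIM('a) / 2"
  define C where "C = 2 + (t\<^sup>2 + 2 * (norm b)\<^sup>2) / t\<^sup>2"
  define D where "D = ?a * (1 / C) powr (- ?a - 1) * (norm b * (2 + norm b / t))"
  have C: "C \<ge> 1"
    by (simp add: C_def)
  have a: "?a > 0"
    by simp
  have bound: "\<bar>k z - k (b + z)\<bar> \<le> D * (t\<^sup>2 + (norm z)\<^sup>2) powr (- (?a + 1 / 2))" for z
  proof -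
    let ?q = "t\<^sup>2 + (norm z)\<^sup>2"
    have q: "?q > 0"
      using t by (simp add: add_pos_nonneg)
    have "?q / C \<le> ?q"
      using C q by (simp add: divide_le_eq mult_le_cancel_left1)
    moreover have "?q / C \<le> t\<^sup>2 + (norm (b + z))\<^sup>2"
      using quadratic_le_translate[OF t, of "t\<^sup>2" z b] C by (simp add: C_def[symmetric] divide_le_eq mult.commute)
    ultimately have "\<bar>k z - k (b + z)\<bar> \<le> ?a * (?q / C) powr (- ?a - 1) * \<bar>?q - (t\<^sup>2 + (norm (b + z))\<^sup>2)\<bar>"
      unfolding k_def using C q by (intro powr_minus_Lipschitz a) auto
    also have "\<bar>?q - (t\<^sup>2 + (norm (b + z))\<^sup>2)\<bar> \<le> norm b * (2 + norm b / t) * sqrt ?q"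
    proof -
      have "\<bar>?q - (t\<^sup>2 + (norm (b + z))\<^sup>2)\<bar> = \<bar>norm z - norm (b + z)\<bar> * (norm z + norm (b + z))"
      proof -
        have "?q - (t\<^sup>2 + (norm (b + z))\<^sup>2) = (norm z - norm (b + z)) * (norm z + norm (b + z))"
          by (simp add: power2_eq_square algebra_simps)
        then show ?thesis
          by (simp only: abs_mult) simp
      qed
      also have "\<dots> \<le> norm b * (2 * norm z + norm b)"
      proof (intro mult_mono)
        show "\<bar>norm z - norm (b + z)\<bar> \<le> norm b"
          using norm_triangle_ineq3[of z "b + z"] by simp
        show "norm z + norm (b + z) \<le> 2 * norm z + norm b"
          using norm_triangle_ineq[of b z] by simp
      qed auto
      also have "\<dots> \<le> norm b * (2 * sqrt ?q + norm b / t * sqrt ?q)"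
      proof (intro mult_left_mono add_mono)
        show "norm z \<le> sqrt ?q"
          by (intro real_le_rsqrt) simp
        have "t \<le> sqrt ?q"
          by (intro real_le_rsqrt) simp
        then have "norm b / t * t \<le> norm b / t * sqrt ?q"
          using t by (intro mult_left_mono) auto
        then show "norm b \<le> norm b / t * sqrt ?q"
          using t by simp
      qed auto
      finally show ?thesis
        by (simp add: algebra_simps)
    qed
    also have "(?q / C) powr (- ?a - 1) = (1 / C) powr (- ?a - 1) * ?q powr (- ?a - 1)"
      using C q by (simp flip: powr_mult)
    also have "?a * ((1 / C) powr (- ?a - 1) * ?q powr (- ?a - 1)) * (norm b * (2 + norm b / t) * sqrt ?q) =
        D * (?q powr (- ?a - 1) * ?q powr (1 / 2))"
      using q by (simp add: D_def powr_half_sqrt)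
    also have "?q powr (- ?a - 1) * ?q powr (1 / 2) = ?q powr (- (?a + 1 / 2))"
      unfolding powr_add[symmetric] by (rule arg_cong[where f = "(powr) ?q"]) simp
    finally show ?thesis
      using a by (simp add: mult_left_mono)
  qed
  show ?thesis
  proof (rule Bochner_Integration.integrable_bound)
    show "integrable lborel (\<lambda>z :: 'a. D * (t\<^sup>2 + (norm z)\<^sup>2) powr (- (?a + 1 / 2)))"
      by (intro integrable_mult_right integrable_quadratic_powr t) simp
    show "(\<lambda>z. k z - k (b + z)) \<in> borel_measurable lborel"
      unfolding k_def by measurable
    show "AE z in lborel. norm (k z - k (b + z)) \<le> norm (D * (t\<^sup>2 + (norm z)\<^sup>2) powr (- (?a + 1 / 2)))"
      using bound by (intro AE_I2) (metis abs_ge_self order_trans real_norm_def)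
  qed
qed

text \<open>
  The symmetry of the bubble: seen from \<open>b\<close>, its quadratic form is reproduced by the inversion of radius
  \<open>sqrt A\<close>, up to the factor \<open>A / |z|\<^sup>2\<close>. Only this value of \<open>A\<close> makes the constant terms match.
\<close>

lemma quadratic_inversion:
  fixes b z :: "'a::euclidean_space"
  assumes t: "t > 0" and z: "z \<noteq> 0"
  defines "A \<equiv> t\<^sup>2 + (norm b)\<^sup>2"
  shows "t\<^sup>2 + (norm (b + inversion A z))\<^sup>2 = A * (t\<^sup>2 + (norm (b + z))\<^sup>2) / (norm z)\<^sup>2"
proof -
  define s where "s = (norm z)\<^sup>2"
  have s: "s > 0"
    using z by (simp add: s_def)
  have n: "(norm (b + c *\<^sub>R z))\<^sup>2 = (norm b)\<^sup>2 + 2 * c * (b \<bullet> z) + c\<^sup>2 * s" for c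
    using dot_norm[of b "c *\<^sub>R z"] by (simp add: s_def power_mult_distrib)
  have "t\<^sup>2 + (norm (b + inversion A z))\<^sup>2 = A + 2 * (A / s) * (b \<bullet> z) + (A / s)\<^sup>2 * s"
    unfolding inversion_def s_def[symmetric] n by (simp add: A_def)
  also have "\<dots> = A * (A + 2 * (b \<bullet> z) + s) / s"
    using s by (simp add: field_simps power2_eq_square)
  also have "A + 2 * (b \<bullet> z) + s = t\<^sup>2 + (norm (b + z))\<^sup>2"
    using n[of 1] by (simp add: A_def)
  finally show ?thesis
    by (simp add: s_def)
qed

lemma norm_inversion:
  assumes "A > 0" "z \<noteq> 0"
  shows "norm (inversion A z) = A / norm z"
  using assms by (simp add: inversion_def power2_eq_square)

section \<open>Potential and logarithmic Laplacian of the bubble\<close>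

text \<open>
  The inversion exchanges the positive part of \<open>ln (|z|\<^sup>2 / A) W (b + z)\<close> with the negative part. So
  both have the same integral, and the negative part, which carries the singularity at \<open>z = 0\<close>, is
  integrable because the positive part is.
\<close>

lemma bubble_potential:
  fixes b :: "'a::euclidean_space"
  assumes t: "t > 0"
  defines "A \<equiv> t\<^sup>2 + (norm b)\<^sup>2"
  defines "W \<equiv> \<lambda>y :: 'a. (t / (t\<^sup>2 + (norm y)\<^sup>2)) powr DIM('a)"
  shows "integrable lborel (\<lambda>z. ln ((norm z)\<^sup>2 / A) * W (b + z))"
    and "(LINT z|lborel. ln ((norm z)\<^sup>2 / A) * W (b + z)) = 0"
proof -
  have A: "A > 0"
    using t by (simp add: A_def add_pos_nonneg)
  have W_nonneg: "W y \<ge> 0" for y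
    by (simp add: W_def)
  have [measurable]: "W \<in> borel_measurable borel"
    unfolding W_def by measurable
  let ?G = "\<lambda>z. max 0 (ln ((norm z)\<^sup>2 / A)) * W (b + z)"
  let ?H = "\<lambda>z. max 0 (- ln ((norm z)\<^sup>2 / A)) * W (b + z)"
  have swap: "?H (inversion A z) * norm (inversion A z) ^ DIM('a) / norm z ^ DIM('a) = ?G z" for z
  proof (cases "z = 0")
    case False
    then have z: "norm z > 0"
      by simp
    have "W (b + inversion A z) = (((norm z)\<^sup>2 / A) * (t / (t\<^sup>2 + (norm (b + z))\<^sup>2))) powr DIM('a)"
      unfolding W_def A_def quadratic_inversion[OF t False] by (simp add: field_simps)
    also have "\<dots> = ((norm z)\<^sup>2 / A) ^ DIM('a) * W (b + z)"
    proof (subst powr_mult)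
      have "(norm z)\<^sup>2 / A > 0"
        using z A by simp
      then show "((norm z)\<^sup>2 / A) powr DIM('a) * (t / (t\<^sup>2 + (norm (b + z))\<^sup>2)) powr DIM('a) =
          ((norm z)\<^sup>2 / A) ^ DIM('a) * W (b + z)"
        unfolding W_def by (simp only: powr_realpow)
    qed
    finally have W: "W (b + inversion A z) * norm (inversion A z) ^ DIM('a) / norm z ^ DIM('a) = W (b + z)"
      unfolding norm_inversion[OF A False] using z A
      by (simp add: power_divide power2_eq_square power_mult_distrib)
    have L: "- ln ((norm (inversion A z))\<^sup>2 / A) = ln ((norm z)\<^sup>2 / A)"
      unfolding norm_inversion[OF A False] using z A
      by (simp add: ln_div ln_mult power2_eq_square)
    show ?thesis
      unfolding L W[symmetric] by (simp add: mult.assoc)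
  qed (simp add: inversion_def)
  define C where "C = 2 + (0 + 2 * (norm b)\<^sup>2) / t\<^sup>2"
  have G: "integrable lborel ?G"
  proof (rule Bochner_Integration.integrable_bound)
    \<comment> \<open>A logarithm is at most four times a fourth root, which costs an exponent \<open>1/4\<close>; \<open>N - 1/4 > N / 2\<close> holds for all \<open>N \<ge> 1\<close>.\<close>
    let ?D = "4 * (C / A + 1 / t\<^sup>2) powr (1 / 4) * t ^ DIM('a)"
    let ?q = "\<lambda>z :: 'a. t\<^sup>2 + (norm (b + z))\<^sup>2"
    have "real DIM('a) / 2 < real DIM('a) - 1 / 4"
    proof -
      have "real DIM('a) \<ge> 1"
        using DIM_positive[where 'a = 'a] by linarith
      then show ?thesis
        by linarith
    qed
    from integrable_quadratic_powr[OF t this]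
    show "integrable lborel (\<lambda>z. ?D * ?q z powr (- (real DIM('a) - 1 / 4)))"
      by (intro integrable_mult_right lborel_translate(1)[THEN iffD2]) simp_all
    show "AE z in lborel. norm (?G z) \<le> norm (?D * ?q z powr (- (real DIM('a) - 1 / 4)))"
    proof (intro AE_I2)
      fix z :: 'a
      have q: "?q z > 0"
        using t by (simp add: add_pos_nonneg)
      have "(norm z)\<^sup>2 \<le> C * ?q z"
        using quadratic_le_translate[OF t order_refl, of z b] by (simp add: C_def)
      then have 1: "(norm z)\<^sup>2 / A \<le> (C / A + 1 / t\<^sup>2) * ?q z"
        using A q t by (simp add: distrib_right divide_right_mono add_increasing2)
      have 2: "1 \<le> (C / A + 1 / t\<^sup>2) * ?q z"
      proof -
        have "1 / t\<^sup>2 * ?q z \<ge> 1"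
          using t by (simp add: field_simps)
        moreover have "C / A * ?q z \<ge> 0"
          using A q by (simp add: C_def)
        ultimately show ?thesis
          by (simp add: distrib_right)
      qed
      have Wq: "W (b + z) = t ^ DIM('a) * ?q z powr (- real DIM('a))"
        using t q by (simp add: W_def powr_divide powr_realpow powr_minus_divide)
      have "max 0 (ln ((norm z)\<^sup>2 / A)) \<le> ln ((C / A + 1 / t\<^sup>2) * ?q z)"
      proof (cases "z = 0")
        case False
        then show ?thesis
          using 1 2 A by (intro max.boundedI) (auto intro!: ln_mono)
      qed (use 2 in simp)
      also have "\<dots> \<le> ((C / A + 1 / t\<^sup>2) * ?q z) powr (1 / 4) / (1 / 4)"
        using 2 by (intro ln_powr_bound) auto
      also have "\<dots> = 4 * (C / A + 1 / t\<^sup>2) powr (1 / 4) * ?q z powr (1 / 4)"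
        using q A by (simp add: powr_mult C_def)
      finally have "?G z \<le> 4 * (C / A + 1 / t\<^sup>2) powr (1 / 4) * ?q z powr (1 / 4) * W (b + z)"
        by (rule mult_right_mono[OF _ W_nonneg])
      also have "4 * (C / A + 1 / t\<^sup>2) powr (1 / 4) * ?q z powr (1 / 4) * W (b + z) =
          ?D * (?q z powr (1 / 4) * ?q z powr (- real DIM('a)))"
        unfolding Wq by simp
      also have "?q z powr (1 / 4) * ?q z powr (- real DIM('a)) = ?q z powr (- (real DIM('a) - 1 / 4))"
        unfolding powr_add[symmetric] by (rule arg_cong[where f = "(powr) (?q z)"]) simp
      finally show "norm (?G z) \<le> norm (?D * ?q z powr (- (real DIM('a) - 1 / 4)))"
        using W_nonneg[of "b + z"] t by simp
    qed
  qed measurable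
  note inv = integral_inversion[OF _ A, of "\<lambda>z. ?H z * norm z ^ DIM('a)", unfolded swap]
  have cancel: "?H z * norm z ^ DIM('a) / norm z ^ DIM('a) = ?H z" for z
    by (cases "z = 0") auto
  have H: "integrable lborel ?H" "integral\<^sup>L lborel ?H = integral\<^sup>L lborel ?G"
    using inv(1) inv(2) G unfolding cancel by simp_all
  have split: "ln ((norm z)\<^sup>2 / A) * W (b + z) = ?G z - ?H z" for z
    by (simp add: max_def algebra_simps)
  show "integrable lborel (\<lambda>z. ln ((norm z)\<^sup>2 / A) * W (b + z))"
    unfolding split using G H(1) by (rule Bochner_Integration.integrable_diff)
  show "(LINT z|lborel. ln ((norm z)\<^sup>2 / A) * W (b + z)) = 0"
    unfolding split using G H by (simp add: Bochner_Integration.integral_diff)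
qed

text \<open>
  The inversion moves the singularity at \<open>z = 0\<close>, where the cancellation of \<open>w b\<close> and \<open>w (b + z)\<close> matters, to
  infinity, and the ball of the cut-off to the exterior of the ball of radius \<open>A\<close>. The result
  splits into the integrand of \<open>cutoff_bubble\<close> and an integrand whose integral vanishes by symmetry.
\<close>

lemma bubble_logarithmic_laplacian:
  fixes b :: "'a::euclidean_space"
  assumes t: "t > 0"
  defines "a \<equiv> real DIM('a) / 2" and "A \<equiv> t\<^sup>2 + (norm b)\<^sup>2"
  defines "w \<equiv> \<lambda>y :: 'a. (t / (t\<^sup>2 + (norm y)\<^sup>2)) powr a"
  shows "(LINT z|lborel. (w b * indicator (ball 0 1) z - w (b + z)) / norm z ^ DIM('a)) =
           w b * (pi powr a / Gamma a * (Digamma a + euler_mascheroni + 2 * ln (t / A)))"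
proof -
  have A: "A > 0"
    using t by (simp add: A_def add_pos_nonneg)
  have [measurable]: "w \<in> borel_measurable borel"
    unfolding w_def by measurable
  define k where "k = (\<lambda>z :: 'a. (t\<^sup>2 + (norm z)\<^sup>2) powr (- a))"
  have [measurable]: "k \<in> borel_measurable borel"
    unfolding k_def by measurable
  let ?c = "\<lambda>z :: 'a. indicator {A<..} (norm z) / norm z ^ DIM('a) - k z"
  define f where "f = (\<lambda>z. w b * indicator (ball 0 1) z - w (b + z))"
  have [measurable]: "f \<in> borel_measurable borel"
  proof -
    have "indicator (ball (0 :: 'a) 1) \<in> borel_measurable borel"
      by (intro borel_measurable_indicator) simp
    moreover have "(\<lambda>z. w (b + z)) \<in> borel_measurable borel"
      by measurable
    ultimately show ?thesis
      unfolding f_def by (intro borel_measurable_diff borel_measurable_times) auto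
  qed
  have wb: "w b = (t / A) powr a"
    by (simp add: w_def A_def)
  have inv: "f (inversion A z) / norm z ^ DIM('a) = w b * (?c z + (k z - k (b + z)))" if z: "z \<noteq> 0" for z
  proof -
    have nz: "norm z > 0"
      using z by simp
    have "w (b + inversion A z) = ((norm z)\<^sup>2 * (t / A) * (1 / (t\<^sup>2 + (norm (b + z))\<^sup>2))) powr a"
      unfolding w_def A_def quadratic_inversion[OF t z] by (simp add: field_simps)
    also have "\<dots> = norm z ^ DIM('a) * w b * k (b + z)"
    proof -
      have "t\<^sup>2 + (norm (b + z))\<^sup>2 > 0"
        using t by (simp add: add_pos_nonneg)
      moreover have "((norm z)\<^sup>2) powr a = norm z ^ DIM('a)"
        unfolding a_def using nz by (rule square_powr_half)
      ultimately show ?thesis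
        using t A by (simp add: powr_mult wb k_def powr_divide powr_minus_divide)
    qed
    finally have 1: "w (b + inversion A z) = norm z ^ DIM('a) * w b * k (b + z)" .
    have 2: "indicator (ball 0 1) (inversion A z) = (indicator {A<..} (norm z) :: real)"
      using norm_inversion[OF A z] nz by (simp add: indicator_def)
    show ?thesis
      unfolding f_def 1 2 using z by (simp add: diff_divide_distrib algebra_simps)
  qed
  have c: "integrable lborel ?c" "(LINT z|lborel. ?c z) = pi powr a / Gamma a * (Digamma a + euler_mascheroni + 2 * ln (t / A))"
    unfolding k_def a_def using cutoff_bubble[where 'a = 'a, OF t A] by auto
  have d: "integrable lborel (\<lambda>z. k z - k (b + z))"
    unfolding k_def a_def by (rule integrable_quadratic_powr_diff[OF t])
  have "(LINT z|lborel. f z / norm z ^ DIM('a)) = (LINT z|lborel. f (inversion A z) / norm z ^ DIM('a))"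
    by (rule integral_inversion(2)[OF _ A, symmetric]) measurable
  also have "\<dots> = (LINT z|lborel. w b * (?c z + (k z - k (b + z))))"
  proof (rule integral_cong_AE)
    show "AE z in lborel. f (inversion A z) / norm z ^ DIM('a) = w b * (?c z + (k z - k (b + z)))"
      by (rule AE_mp[OF AE_lborel_singleton[of 0]], rule AE_I2) (use inv in auto)
  qed measurable
  also have "\<dots> = w b * ((LINT z|lborel. ?c z) + (LINT z|lborel. k z - k (b + z)))"
    by (simp only: integral_mult_right_zero Bochner_Integration.integral_add[OF c(1) d])
  also have "(LINT z|lborel. k z - k (b + z)) = 0"
    by (rule integral_even_translate_diff) (auto simp: k_def)
  finally show ?thesis
    unfolding c(2) f_def by simp
qed

section \<open>The function classes\<close>

lemma lebesgue_eq_lborel: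
  fixes f :: "'a::euclidean_space \<Rightarrow> real"
  assumes "f \<in> borel_measurable borel"
  shows "integrable lebesgue f \<longleftrightarrow> integrable lborel f"
    and "integral\<^sup>L lebesgue f = integral\<^sup>L lborel f"
  using assms by (simp_all add: integrable_completion integral_completion)

text \<open>
  The weight supplies another power \<open>- N / 2\<close> of \<open>t\<^sup>2 + |x|\<^sup>2\<close>, so the integrand decays like the squared bubble.
\<close>

lemma bubble_in_L10:
  fixes x0 :: "real ^ 'n"
  assumes t: "t > 0" and \<kappa>: "\<kappa> \<ge> 0"
  shows "(\<lambda>x. \<kappa> * (t / (t\<^sup>2 + (norm (x - x0))\<^sup>2)) powr (real CARD('n) / 2)) \<in> L10"
proof -
  let ?n = "CARD('n)" and ?a = "real CARD('n) / 2"
  let ?q = "\<lambda>x. t\<^sup>2 + (norm (x - x0))\<^sup>2"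
  let ?u = "\<lambda>x. \<kappa> * (t / ?q x) powr ?a"
  have n: "?n > 0"
    by simp
  have u: "?u \<in> borel_measurable borel"
    by measurable
  define C where "C = 2 + (t\<^sup>2 + 2 * (norm x0)\<^sup>2) / 1\<^sup>2"
  have C: "C > 0"
    by (simp add: C_def add_pos_nonneg)
  have q: "?q x > 0" for x
    using t by (simp add: add_pos_nonneg)
  have weight: "?q x powr ?a \<le> (2 * C) powr ?a * (1 + norm x ^ ?n)" for x
  proof -
    have "?q x \<le> C * (1 + (norm x)\<^sup>2)"
      using quadratic_le_translate[of 1 "t\<^sup>2" "x - x0" x0] by (simp add: C_def)
    also have "\<dots> \<le> C * (2 * (max 1 (norm x))\<^sup>2)"
    proof (intro mult_left_mono)
      have "(norm x)\<^sup>2 \<le> (max 1 (norm x))\<^sup>2" "1 \<le> (max 1 (norm x))\<^sup>2"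
        by (auto intro: power_mono one_le_power)
      then show "1 + (norm x)\<^sup>2 \<le> 2 * (max 1 (norm x))\<^sup>2"
        by linarith
    qed (use C in simp)
    finally have "?q x powr ?a \<le> ((2 * C) * (max 1 (norm x))\<^sup>2) powr ?a"
      using q[of x] by (intro powr_mono2) (auto simp: mult_ac)
    also have "\<dots> = (2 * C) powr ?a * max 1 (norm x) ^ ?n"
      using C by (subst powr_mult) (simp_all add: square_powr_half)
    also have "max 1 (norm x) ^ ?n \<le> 1 + norm x ^ ?n"
      by (simp add: max_def)
    finally show ?thesis
      using C by (simp add: mult_left_mono)
  qed
  have "integrable lborel (\<lambda>x. \<bar>?u x\<bar> / (1 + norm x ^ ?n))"
  proof (rule Bochner_Integration.integrable_bound)
    let ?D = "\<kappa> * t powr ?a * (2 * C) powr ?a"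
    have "integrable lborel (\<lambda>z :: real ^ 'n. (t\<^sup>2 + (norm z)\<^sup>2) powr (- real ?n))"
      using t by (intro integrable_quadratic_powr) auto
    then show "integrable lborel (\<lambda>x. ?D * ?q x powr (- real ?n))"
      using lborel_translate(1)[of "\<lambda>z :: real ^ 'n. (t\<^sup>2 + (norm z)\<^sup>2) powr (- real ?n)" "- x0"]
      by (intro integrable_mult_right) simp
    show "(\<lambda>x. \<bar>?u x\<bar> / (1 + norm x ^ ?n)) \<in> borel_measurable lborel"
      by measurable
    show "AE x in lborel. norm (\<bar>?u x\<bar> / (1 + norm x ^ ?n)) \<le> norm (?D * ?q x powr (- real ?n))"
    proof (intro AE_I2)
      fix x :: "real ^ 'n"
      have pos: "1 + norm x ^ ?n > 0"
        by (simp add: add_pos_nonneg)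
      have "?u x = \<kappa> * t powr ?a * (?q x powr ?a * ?q x powr (- real ?n))"
        unfolding powr_add[symmetric] using t q[of x] by (simp add: powr_divide powr_minus_divide)
      also have "\<dots> \<le> \<kappa> * t powr ?a * (((2 * C) powr ?a * (1 + norm x ^ ?n)) * ?q x powr (- real ?n))"
        using weight[of x] \<kappa> by (intro mult_left_mono mult_right_mono) auto
      also have "\<dots> = ?D * ?q x powr (- real ?n) * (1 + norm x ^ ?n)"
        by simp
      finally have "?u x / (1 + norm x ^ ?n) \<le> ?D * ?q x powr (- real ?n)"
        using pos by (simp only: pos_divide_le_eq)
      then show "norm (\<bar>?u x\<bar> / (1 + norm x ^ ?n)) \<le> norm (?D * ?q x powr (- real ?n))"
        using pos \<kappa> by (simp add: abs_mult)
    qed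
  qed
  then have "integrable lebesgue (\<lambda>x. \<bar>?u x\<bar> / (1 + norm x ^ ?n))"
    by (subst lebesgue_eq_lborel) measurable
  moreover have "?u \<in> borel_measurable lebesgue"
    using u by (simp add: measurable_completion)
  ultimately show ?thesis
    by (simp add: L10_def)
qed

text \<open>
  The bubble is Lipschitz near each point, so its modulus of continuity is at most \<open>L r\<close> for \<open>r < 1\<close>.
\<close>

lemma bubble_in_D0:
  fixes x0 :: "real ^ 'n"
  assumes t: "t > 0"
  shows "(\<lambda>x. \<kappa> * (t / (t\<^sup>2 + (norm (x - x0))\<^sup>2)) powr (real CARD('n) / 2)) \<in> D0"
proof -
  let ?a = "real CARD('n) / 2"
  let ?q = "\<lambda>x. t\<^sup>2 + (norm (x - x0))\<^sup>2"
  let ?u = "\<lambda>x. \<kappa> * (t / ?q x) powr ?a"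
  have u: "?u x = \<kappa> * t powr ?a * ?q x powr (- ?a)" for x
    using t by (simp add: powr_divide powr_minus_divide)
  have "(\<integral>\<^sup>+r\<in>{0<..<1}. dini_modulus ?u x r / ennreal r \<partial>lebesgue) < \<infinity>" for x
  proof -
    define L where "L = \<bar>\<kappa> * t powr ?a\<bar> * (?a * (t\<^sup>2) powr (- ?a - 1)) * (2 * norm (x - x0) + 1)"
    have L: "L \<ge> 0"
      by (simp add: L_def)
    have Lip: "\<bar>?u y - ?u x\<bar> \<le> L * r" if y: "y \<in> cball x r" and r: "0 < r" "r < 1" for y r
    proof -
      have xy: "norm (y - x) \<le> r"
        using y by (simp add: dist_norm norm_minus_commute)
      have "?q y - ?q x = (norm (y - x0) - norm (x - x0)) * (norm (y - x0) + norm (x - x0))"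
        by (simp add: power2_eq_square algebra_simps)
      then have "\<bar>?q y - ?q x\<bar> = \<bar>norm (y - x0) - norm (x - x0)\<bar> * (norm (y - x0) + norm (x - x0))"
        by (simp only: abs_mult) simp
      also have "\<dots> \<le> r * (2 * norm (x - x0) + 1)"
      proof (intro mult_mono)
        show "\<bar>norm (y - x0) - norm (x - x0)\<bar> \<le> r"
          using norm_triangle_ineq3[of "y - x0" "x - x0"] xy by simp
        show "norm (y - x0) + norm (x - x0) \<le> 2 * norm (x - x0) + 1"
          using norm_triangle_ineq[of "y - x" "x - x0"] xy r by simp
      qed (use r in auto)
      finally have qq: "\<bar>?q y - ?q x\<bar> \<le> r * (2 * norm (x - x0) + 1)" .
      have "\<bar>?q y powr (- ?a) - ?q x powr (- ?a)\<bar> \<le> ?a * (t\<^sup>2) powr (- ?a - 1) * \<bar>?q y - ?q x\<bar>"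
        using t by (intro powr_minus_Lipschitz) auto
      also have "\<dots> \<le> ?a * (t\<^sup>2) powr (- ?a - 1) * (r * (2 * norm (x - x0) + 1))"
        using qq by (intro mult_left_mono) auto
      finally have "\<bar>\<kappa> * t powr ?a\<bar> * \<bar>?q y powr (- ?a) - ?q x powr (- ?a)\<bar> \<le>
          \<bar>\<kappa> * t powr ?a\<bar> * (?a * (t\<^sup>2) powr (- ?a - 1) * (r * (2 * norm (x - x0) + 1)))"
        by (rule mult_left_mono) simp
      also have "\<dots> = L * r"
        by (simp only: L_def mult_ac)
      also have "\<bar>\<kappa> * t powr ?a\<bar> * \<bar>?q y powr (- ?a) - ?q x powr (- ?a)\<bar> = \<bar>?u y - ?u x\<bar>"
        unfolding u by (simp only: right_diff_distrib[symmetric] abs_mult)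
      finally show ?thesis .
    qed
    have "(\<integral>\<^sup>+r\<in>{0<..<1}. dini_modulus ?u x r / ennreal r \<partial>lebesgue)
        \<le> (\<integral>\<^sup>+r. ennreal L * indicator {0<..<1} r \<partial>(lebesgue :: real measure))"
    proof (intro nn_integral_mono)
      fix r :: real
      show "dini_modulus ?u x r / ennreal r * indicator {0<..<1} r \<le> ennreal L * indicator {0<..<1} r"
      proof (cases "r \<in> {0<..<1}")
        case True
        then have "dini_modulus ?u x r \<le> ennreal (L * r)"
          unfolding dini_modulus_def using Lip[of _ r] by (intro SUP_least ennreal_leI) auto
        then have "dini_modulus ?u x r / ennreal r \<le> ennreal (L * r) / ennreal r"
          by (rule divide_right_mono_ennreal)
        also have "\<dots> = ennreal L"
          using True L by (simp add: divide_ennreal)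
        finally show ?thesis
          by (intro mult_right_mono) auto
      qed simp
    qed
    also have "\<dots> = ennreal L"
      by (subst nn_integral_cmult_indicator) auto
    finally show ?thesis
      by (simp add: le_less_trans)
  qed
  then show ?thesis
    by (simp add: D0_def)
qed

text \<open>
  The first logarithm costs an arbitrarily small power of \<open>t\<^sup>2 + |x|\<^sup>2\<close>. The second one is an affine function of
  the logarithm in \<open>bubble_entropy\<close>.
\<close>

lemma bubble_in_Hln:
  fixes x0 :: "real ^ 'n"
  assumes t: "t > 0" and \<kappa>: "\<kappa> > 0"
  shows "(\<lambda>x. \<kappa> * (t / (t\<^sup>2 + (norm (x - x0))\<^sup>2)) powr (real CARD('n) / 2)) \<in> Hln"
proof -
  let ?n = "CARD('n)" and ?a = "real CARD('n) / 2"
  let ?q = "\<lambda>x. t\<^sup>2 + (norm (x - x0))\<^sup>2"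
  let ?u = "\<lambda>x. \<kappa> * (t / ?q x) powr ?a"
  let ?W = "\<lambda>x. (t / ?q x) powr real ?n"
  have q: "?q x > 0" for x
    using t by (simp add: add_pos_nonneg)
  have [measurable]: "?u \<in> borel_measurable borel"
    by measurable
  have sq: "(?u x)\<^sup>2 = \<kappa>\<^sup>2 * ?W x" for x
    using t q[of x] by (simp add: power_mult_distrib powr_power)
  have shift: "integrable lborel (\<lambda>x. f (x - x0))" if "f \<in> borel_measurable borel" "integrable lborel f"
    for f :: "real ^ 'n \<Rightarrow> real"
    using lborel_translate(1)[of f "- x0"] that by simp
  have W: "integrable lborel ?W"
    using shift[OF _ bubble_mass(1)[where 'a = "real ^ 'n", OF t]] by simp
  have WL: "integrable lborel (\<lambda>x. ?W x * ln (t / ?q x))"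
    using shift[OF _ bubble_entropy(1)[where 'a = "real ^ 'n", OF t]] by simp
  have 1: "integrable lborel (\<lambda>x. (?u x)\<^sup>2)"
    unfolding sq using W by (rule integrable_mult_right)
  have 2: "integrable lborel (\<lambda>x. (?u x)\<^sup>2 * ln (exp 1 + (norm x)\<^sup>2))"
  proof (rule Bochner_Integration.integrable_bound)
    define C where "C = 2 + (exp 1 + 2 * (norm (- x0))\<^sup>2) / t\<^sup>2"
    have C: "C > 0"
      by (simp add: C_def add_pos_nonneg)
    let ?D = "\<kappa>\<^sup>2 * t ^ ?n * (4 * C powr (1 / 4))"
    have "real DIM(real ^ 'n) / 2 < real ?n - 1 / 4"
    proof -
      have "real ?n \<ge> 1"
        using zero_less_card_finite[where 'a = 'n] by linarith
      moreover have "DIM(real ^ 'n) = ?n"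
        by simp
      ultimately show ?thesis
        by linarith
    qed
    from shift[OF _ integrable_quadratic_powr[OF t this]]
    show "integrable lborel (\<lambda>x. ?D * ?q x powr (- (real ?n - 1 / 4)))"
      by (intro integrable_mult_right) simp
    show "(\<lambda>x. (?u x)\<^sup>2 * ln (exp 1 + (norm x)\<^sup>2)) \<in> borel_measurable lborel"
      by measurable
    show "AE x in lborel. norm ((?u x)\<^sup>2 * ln (exp 1 + (norm x)\<^sup>2)) \<le> norm (?D * ?q x powr (- (real ?n - 1 / 4)))"
    proof (intro AE_I2)
      fix x :: "real ^ 'n"
      have e: "exp 1 + (norm x)\<^sup>2 \<ge> 1"
        by (simp add: add_increasing2)
      have uq: "(?u x)\<^sup>2 = \<kappa>\<^sup>2 * t ^ ?n * ?q x powr (- real ?n)"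
        unfolding sq using t q[of x] by (simp add: powr_divide powr_realpow powr_minus_divide)
      have "ln (exp 1 + (norm x)\<^sup>2) \<le> (exp 1 + (norm x)\<^sup>2) powr (1 / 4) / (1 / 4)"
        using e by (intro ln_powr_bound) auto
      also have "(exp 1 + (norm x)\<^sup>2) powr (1 / 4) \<le> (C * ?q x) powr (1 / 4)"
        using quadratic_le_translate[OF t, of "exp 1" x "- x0"] e
        by (intro powr_mono2) (auto simp: C_def)
      also have "(C * ?q x) powr (1 / 4) = C powr (1 / 4) * ?q x powr (1 / 4)"
        using C q[of x] by (simp add: powr_mult)
      finally have "(?u x)\<^sup>2 * ln (exp 1 + (norm x)\<^sup>2) \<le> (?u x)\<^sup>2 * (4 * C powr (1 / 4) * ?q x powr (1 / 4))"
        by (intro mult_left_mono) auto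
      also have "(?u x)\<^sup>2 * (4 * C powr (1 / 4) * ?q x powr (1 / 4)) =
          ?D * (?q x powr (- real ?n) * ?q x powr (1 / 4))"
        unfolding uq by simp
      also have "?q x powr (- real ?n) * ?q x powr (1 / 4) = ?q x powr (- (real ?n - 1 / 4))"
        unfolding powr_add[symmetric] by (rule arg_cong[where f = "(powr) (?q x)"]) simp
      finally show "norm ((?u x)\<^sup>2 * ln (exp 1 + (norm x)\<^sup>2)) \<le> norm (?D * ?q x powr (- (real ?n - 1 / 4)))"
        using e t by simp
    qed
  qed
  have ln_u: "(?u x)\<^sup>2 * ln \<bar>?u x\<bar> = \<kappa>\<^sup>2 * ln \<kappa> * ?W x + \<kappa>\<^sup>2 * ?a * (?W x * ln (t / ?q x))" for x
  proof -
    have "ln \<bar>\<kappa> * y powr ?a\<bar> = ln \<kappa> + ?a * ln y" if "y > 0" for y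
      using \<kappa> that by (simp add: ln_mult ln_powr abs_mult)
    then have "ln \<bar>?u x\<bar> = ln \<kappa> + ?a * ln (t / ?q x)"
      using t q[of x] by simp
    then show ?thesis
      unfolding sq by (simp only: algebra_simps)
  qed
  have 3: "integrable lborel (\<lambda>x. (?u x)\<^sup>2 * ln \<bar>?u x\<bar>)"
    unfolding ln_u using W WL by (intro Bochner_Integration.integrable_add integrable_mult_right)
  have "?u \<in> borel_measurable lebesgue"
    by (simp add: measurable_completion)
  moreover have "integrable lebesgue (\<lambda>x. (?u x)\<^sup>2)"
    using 1 by (subst lebesgue_eq_lborel) measurable
  moreover have "integrable lebesgue (\<lambda>x. (?u x)\<^sup>2 * ln (exp 1 + (norm x)\<^sup>2))"
    using 2 by (subst lebesgue_eq_lborel) measurable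
  moreover have "integrable lebesgue (\<lambda>x. (?u x)\<^sup>2 * ln \<bar>?u x\<bar>)"
    using 3 by (subst lebesgue_eq_lborel) measurable
  ultimately show ?thesis
    by (simp add: Hln_def)
qed

section \<open>The equation\<close>

theorem theorem1p2:
  fixes \<sigma> t :: real and x0 :: "real ^ 'n" and u :: "real ^ 'n \<Rightarrow> real"
  assumes "t > 0"
    and "u = (\<lambda>x. exp (real CARD('n) / 4 * (\<sigma> - BL_const CARD('n))) * B0_const CARD('n)
                    * (t / (t\<^sup>2 + (norm (x - x0))\<^sup>2)) powr (real CARD('n) / 2))"
  shows "classical_solution
           (\<lambda>v x. \<sigma> * v x
              + 1 / (L2_norm v)\<^sup>2
                * (G_ln v x - 4 / real CARD('n) * (LINT y|lebesgue. (v y)\<^sup>2 * ln (v y)))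
                * v x)
           u"
proof -
  let ?n = "CARD('n)"
  define a where "a = real ?n / 2"
  have n: "real ?n > 0"
    by simp
  have a: "a > 0" "2 * a = real ?n"
    by (simp_all add: a_def)
  have t: "t > 0" by fact
  define q where "q = (\<lambda>y :: real ^ 'n. t\<^sup>2 + (norm y)\<^sup>2)"
  define w where "w = (\<lambda>y :: real ^ 'n. (t / q y) powr a)"
  define W where "W = (\<lambda>y :: real ^ 'n. (t / q y) powr real ?n)"
  define \<kappa> where "\<kappa> = exp (real ?n / 4 * (\<sigma> - BL_const ?n)) * B0_const ?n"
  define I where "I = pi powr a / Gamma a * Beta a a"
  have q: "q y > 0" for y
    using t by (simp add: q_def add_pos_nonneg)
  have Gamma: "Gamma a > 0" "Gamma (real ?n) > 0"
    using Gamma_real_pos[OF a(1)] Gamma_real_pos[OF n] by blast+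
  have I: "I > 0"
    unfolding I_def Beta_def using Gamma by (simp flip: a(2))
  have B0: "B0_const ?n > 0"
    using Gamma by (simp add: B0_const_def a_def)
  then have \<kappa>: "\<kappa> > 0"
    by (simp add: \<kappa>_def)
  have [measurable]: "w \<in> borel_measurable borel" "W \<in> borel_measurable borel" "q \<in> borel_measurable borel"
    unfolding w_def W_def q_def by measurable
  have u: "u x = \<kappa> * w (x - x0)" for x
    by (simp add: assms(2) \<kappa>_def w_def q_def a_def)
  have [measurable]: "u \<in> borel_measurable borel"
    unfolding u by measurable
  have sq: "(\<kappa> * w y)\<^sup>2 = \<kappa>\<^sup>2 * W y" for y
    using t q[of y] a by (simp add: w_def W_def power_mult_distrib powr_power)
  have mass: "integrable lborel W" "(LINT y|lborel. W y) = I"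
    unfolding W_def I_def a_def q_def using bubble_mass[where 'a = "real ^ 'n", OF t] by simp_all
  have entropy: "integrable lborel (\<lambda>y. W y * ln (t / q y))"
      "(LINT y|lborel. W y * ln (t / q y)) = I * (Digamma a - Digamma ?n - ln t)"
    unfolding W_def I_def q_def a(2)[symmetric] unfolding a_def
    using bubble_entropy[where 'a = "real ^ 'n", OF t] by simp_all
  have centre: "integral\<^sup>L lebesgue f = (LINT y|lborel. f (b + y))" if "f \<in> borel_measurable borel"
    for f :: "real ^ 'n \<Rightarrow> real" and b
    using that by (simp add: lebesgue_eq_lborel(2) lborel_translate(2))
  have L2: "(L2_norm u)\<^sup>2 = \<kappa>\<^sup>2 * I"
  proof -
    have "(LINT x|lebesgue. (u x)\<^sup>2) = (LINT y|lborel. (u (x0 + y))\<^sup>2)"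
      by (rule centre) measurable
    also have "\<dots> = \<kappa>\<^sup>2 * I"
      by (simp add: u sq mass)
    finally show ?thesis
      using I by (simp add: L2_norm_def)
  qed
  have ent: "(LINT y|lebesgue. (u y)\<^sup>2 * ln (u y)) =
      \<kappa>\<^sup>2 * I * (ln \<kappa> + a * (Digamma a - Digamma ?n - ln t))"
  proof -
    have ln_u: "ln (\<kappa> * w y) = ln \<kappa> + a * ln (t / q y)" for y
      using t q[of y] \<kappa> by (simp add: w_def ln_mult ln_powr)
    have "(LINT x|lebesgue. (u x)\<^sup>2 * ln (u x)) = (LINT y|lborel. (u (x0 + y))\<^sup>2 * ln (u (x0 + y)))"
      by (rule centre) measurable
    also have "\<dots> = (LINT y|lborel. \<kappa>\<^sup>2 * ln \<kappa> * W y + \<kappa>\<^sup>2 * a * (W y * ln (t / q y)))"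
      by (simp only: u add_diff_cancel_left' sq ln_u) (simp add: algebra_simps)
    also have "\<dots> = \<kappa>\<^sup>2 * ln \<kappa> * I + \<kappa>\<^sup>2 * a * (I * (Digamma a - Digamma ?n - ln t))"
      using mass entropy by (subst Bochner_Integration.integral_add) simp_all
    finally show ?thesis
      by (simp add: algebra_simps)
  qed
  have G: "G_ln u x = - 2 * \<kappa>\<^sup>2 * I * ln (q (x - x0))" for x
  proof -
    let ?b = "x - x0"
    have powi: "r powi (- 4) = inverse (r ^ 4)" for r :: real
      by (simp add: power_int_minus)
    have P: "integrable lborel (\<lambda>z. ln ((norm z)\<^sup>2 / q ?b) * W (?b + z))"
        "(LINT z|lborel. ln ((norm z)\<^sup>2 / q ?b) * W (?b + z)) = 0"
      using bubble_potential[where 'a = "real ^ 'n", OF t, of ?b] by (simp_all add: W_def q_def)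
    have M: "integrable lborel (\<lambda>z. W (?b + z))" "(LINT z|lborel. W (?b + z)) = I"
      using mass by (simp_all add: lborel_translate)
    have "G_ln u x = (LINT z|lborel. ln (inverse (norm (x - (x + z)) ^ 4)) * (u (x + z))\<^sup>2)"
      unfolding G_ln_def powi by (rule centre) measurable
    also have "\<dots> = (LINT z|lborel. - 2 * \<kappa>\<^sup>2 * (ln ((norm z)\<^sup>2 / q ?b) * W (?b + z)) - 2 * \<kappa>\<^sup>2 * ln (q ?b) * W (?b + z))"
    proof (rule integral_cong_AE)
      have "ln (inverse (norm (x - (x + z)) ^ 4)) * (u (x + z))\<^sup>2 =
          - 2 * \<kappa>\<^sup>2 * (ln ((norm z)\<^sup>2 / q ?b) * W (?b + z)) - 2 * \<kappa>\<^sup>2 * ln (q ?b) * W (?b + z)"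
        if z: "z \<noteq> 0" for z
      proof -
        have e1: "(u (x + z))\<^sup>2 = \<kappa>\<^sup>2 * W (?b + z)"
          by (simp only: u sq add_diff_eq[symmetric] diff_add_eq)
        have e2: "ln (inverse (norm (x - (x + z)) ^ 4)) = - 4 * ln (norm z)"
          using z by (simp add: ln_inverse ln_realpow)
        have e3: "ln ((norm z)\<^sup>2 / q ?b) = 2 * ln (norm z) - ln (q ?b)"
          using z q[of ?b] by (simp add: ln_div ln_realpow)
        show ?thesis
          unfolding e1 e2 e3 by (simp add: algebra_simps)
      qed
      then show "AE z in lborel. ln (inverse (norm (x - (x + z)) ^ 4)) * (u (x + z))\<^sup>2 =
          - 2 * \<kappa>\<^sup>2 * (ln ((norm z)\<^sup>2 / q ?b) * W (?b + z)) - 2 * \<kappa>\<^sup>2 * ln (q ?b) * W (?b + z)"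
        by - (rule AE_mp[OF AE_lborel_singleton[of 0]], rule AE_I2, blast)
    qed measurable
    also have "\<dots> = - 2 * \<kappa>\<^sup>2 * I * ln (q ?b)"
      using P M by (subst Bochner_Integration.integral_diff) simp_all
    finally show ?thesis .
  qed
  have Lap: "log_laplacian u x = u x * (2 * ln 2 + 2 * Digamma a + 2 * ln (t / q (x - x0)))" for x
  proof -
    let ?b = "x - x0"
    have "(LINT y|lebesgue. (u x * indicator (ball x 1) y - u y) / norm (x - y) ^ ?n) =
        (LINT z|lborel. (u x * indicator (ball x 1) (x + z) - u (x + z)) / norm (x - (x + z)) ^ ?n)"
    proof (rule centre)
      have "indicator (ball x 1) \<in> borel_measurable borel"
        by (intro borel_measurable_indicator) simp
      moreover have "(\<lambda>y. norm (x - y) ^ ?n) \<in> borel_measurable borel"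
        by measurable
      ultimately show "(\<lambda>y. (u x * indicator (ball x 1) y - u y) / norm (x - y) ^ ?n) \<in> borel_measurable borel"
        by (intro borel_measurable_divide borel_measurable_diff borel_measurable_times) auto
    qed
    also have "\<dots> = (LINT z|lborel. \<kappa> * ((w ?b * indicator (ball 0 1) z - w (?b + z)) / norm z ^ ?n))"
    proof (rule Bochner_Integration.integral_cong[OF refl])
      fix z
      have "indicator (ball x 1) (x + z) = (indicator (ball 0 1) z :: real)"
        by (simp add: indicator_def dist_norm)
      then show "(u x * indicator (ball x 1) (x + z) - u (x + z)) / norm (x - (x + z)) ^ ?n =
          \<kappa> * ((w ?b * indicator (ball 0 1) z - w (?b + z)) / norm z ^ ?n)"
        by (simp add: u diff_add_eq[symmetric] right_diff_distrib mult_ac)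
    qed
    also have "\<dots> = \<kappa> * (w ?b * (pi powr a / Gamma a * (Digamma a + euler_mascheroni + 2 * ln (t / q ?b))))"
      using bubble_logarithmic_laplacian[where 'a = "real ^ 'n", OF t, of ?b]
      by (simp only: integral_mult_right_zero) (simp add: w_def q_def a_def)
    finally have "log_laplacian u x = c_const ?n * (pi powr a / Gamma a) * (u x * (Digamma a + euler_mascheroni + 2 * ln (t / q ?b)))
        + rho_const ?n * u x"
      by (simp add: log_laplacian_def u mult_ac)
    \<comment> \<open>The normalisation of the logarithmic Laplacian is inverse to the constant of radial integration.\<close>
    also have "c_const ?n * (pi powr a / Gamma a) = 1"
      using Gamma by (simp add: c_const_def a_def[symmetric] powr_minus)
    also have "rho_const ?n = 2 * ln 2 + Digamma a - euler_mascheroni"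
      by (simp add: rho_const_def a_def)
    finally show ?thesis
      by (simp add: algebra_simps)
  qed
  \<comment> \<open>The second term of \<open>BL_const\<close> cancels the contribution of the factor \<open>B0_const\<close>.\<close>
  have ln_\<kappa>: "4 / real ?n * ln \<kappa> = \<sigma> - 2 * (ln 2 + 2 * Digamma a - Digamma ?n)"
  proof -
    have "ln \<kappa> = real ?n / 4 * (\<sigma> - BL_const ?n) + ln (B0_const ?n)"
      using B0 by (simp add: \<kappa>_def ln_mult)
    moreover have "BL_const ?n = 2 * (ln 2 + 2 * Digamma a - Digamma ?n) + 4 / real ?n * ln (B0_const ?n)"
      using B0 by (simp add: BL_const_def B1_const_def a_def)
    ultimately have "4 / real ?n * ln \<kappa> = 4 / real ?n * (real ?n / 4) *
        (\<sigma> - 2 * (ln 2 + 2 * Digamma a - Digamma ?n) - 4 / real ?n * ln (B0_const ?n)) + 4 / real ?n * ln (B0_const ?n)"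
      by (simp only: distrib_left mult.assoc diff_diff_eq)
    then show ?thesis
      using n by simp
  qed
  have eq: "log_laplacian u x = \<sigma> * u x
      + 1 / (L2_norm u)\<^sup>2 * (G_ln u x - 4 / real ?n * (LINT y|lebesgue. (u y)\<^sup>2 * ln (u y))) * u x" for x
  proof -
    let ?b = "x - x0"
    have "1 / (L2_norm u)\<^sup>2 * (G_ln u x - 4 / real ?n * (LINT y|lebesgue. (u y)\<^sup>2 * ln (u y))) =
        1 / (\<kappa>\<^sup>2 * I) * ((\<kappa>\<^sup>2 * I) * (- 2 * ln (q ?b) - (4 / real ?n * ln \<kappa> + 4 / real ?n * a * (Digamma a - Digamma ?n - ln t))))"
      unfolding L2 ent G by (simp add: algebra_simps add_divide_distrib)
    also have "\<dots> = - 2 * ln (q ?b) - (4 / real ?n * ln \<kappa> + 4 / real ?n * a * (Digamma a - Digamma ?n - ln t))"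
      using \<kappa> I by simp
    also have "4 / real ?n * a = 2"
      using n by (simp add: a_def)
    finally have rhs: "1 / (L2_norm u)\<^sup>2 * (G_ln u x - 4 / real ?n * (LINT y|lebesgue. (u y)\<^sup>2 * ln (u y))) =
        - \<sigma> + (2 * ln 2 + 2 * Digamma a + 2 * ln (t / q ?b))"
      unfolding ln_\<kappa> using t q[of ?b] by (simp add: ln_div)
    show ?thesis
      unfolding Lap rhs by (simp add: algebra_simps)
  qed
  have u_eq: "u = (\<lambda>x. \<kappa> * (t / (t\<^sup>2 + (norm (x - x0))\<^sup>2)) powr (real ?n / 2))"
    by (simp add: assms(2) \<kappa>_def)
  have "u \<in> L10 \<inter> D0 \<inter> Hln"
    unfolding u_eq using \<kappa> by (intro IntI bubble_in_L10[OF t] bubble_in_D0[OF t] bubble_in_Hln[OF t]) auto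
  with eq show ?thesis
    by (simp add: classical_solution_def)
qed

end
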